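(* Let $\alpha_1,\dots,\alpha_N>0$ satisfy $\frac{2\alpha_j}{\alpha_{j-1}}=\sqrt{(j-1)(N-j+1)}$ for $2\le j\le N$, and let $W(x)=e^{-x^2}L(x)L(x)^*$, $x\in\mathbb{R}$, where $L(x)_{j,k}=\frac{H_{j-k}(x)}{(j-k)!}\frac{\alpha_j}{\alpha_k}$ for $j\ge k$ and $L(x)_{j,k}=0$ for $j<k$. Let $A$ be the $N\times N$ matrix with $A_{j,j-1}=2\alpha_j/\alpha_{j-1}$ and all other entries zero. Let $P(x,n)$ be the monic matrix valued orthogonal polynomials with respect to $W$, with squared norms $\mathcal{H}(n)$. Then the sequence $M_{-2}(n)$ determined by $$P'(x,n)=n\,P(x,n-1)+M_{-2}(n)\,P(x,n-2)$$ is given by $$M_{-2}(n)=\mathcal{H}(n)\,A^*\,\mathcal{H}(n-2)^{-1},\qquad n\ge2.$$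
   Context: $H_n$ are the standard (physicists') Hermite polynomials (leading coefficient $2^n$). With $\langle F,G\rangle=\int_{\mathbb{R}}F(y)W(y)G(y)^*\,dy$, the monic MVOPs $P(x,n)=x^nI+\cdots$ satisfy $\langle P(\cdot,n),P(\cdot,m)\rangle=\mathcal{H}(n)\delta_{n,m}$ with $\mathcal{H}(n)$ positive definite. Here $'$ is $d/dx$. Because $W'=-WV$ with $V$ a matrix polynomial of degree two, a lowering relation of the displayed form exists for some sequence of matrices $M_{-2}(n)$. *)

theory Defs
  imports
    "HOL-Analysis.Analysis"
    "Jordan_Normal_Form.Gauss_Jordan_Elimination"
    "Jordan_Normal_Form.Schur_Decomposition"
begin

text \<open>
  Matrices are those of \<^theory>\<open>Jordan_Normal_Form.Matrix\<close>, whose entries are indexed from 0, while the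
  parameters \<open>\<alpha> 1, \<dots>, \<alpha> N\<close> are indexed from 1: the entry \<open>(i, k)\<close> below is the mathematical entry
  \<open>(i + 1, k + 1)\<close>.
\<close>

text \<open>Physicists' normalisation: the leading coefficient of \<open>hermite n\<close> is \<open>2 ^ n\<close>.\<close>

fun hermite :: "nat \<Rightarrow> real poly" where
  "hermite 0 = 1"
| "hermite (Suc 0) = [:0, 2:]"
| "hermite (Suc (Suc n)) = [:0, 2:] * hermite (Suc n) - Polynomial.smult (2 * real (Suc n)) (hermite n)"

definition L_mat :: "nat \<Rightarrow> (nat \<Rightarrow> real) \<Rightarrow> real \<Rightarrow> complex mat" where
  "L_mat N \<alpha> x = mat N N (\<lambda>(i, k).
     if k \<le> i
     then complex_of_real (poly (hermite (i - k)) x / fact (i - k) * (\<alpha> (Suc i) / \<alpha> (Suc k)))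
     else 0)"

definition W_mat :: "nat \<Rightarrow> (nat \<Rightarrow> real) \<Rightarrow> real \<Rightarrow> complex mat" where
  "W_mat N \<alpha> x =
     complex_of_real (exp (- (x ^ 2))) \<cdot>\<^sub>m (L_mat N \<alpha> x * mat_adjoint (L_mat N \<alpha> x))"

definition A_mat :: "nat \<Rightarrow> (nat \<Rightarrow> real) \<Rightarrow> complex mat" where
  "A_mat N \<alpha> = mat N N (\<lambda>(i, k).
     if i = Suc k then complex_of_real (2 * \<alpha> (Suc i) / \<alpha> (Suc k)) else 0)"

text \<open>
  A matrix polynomial is a matrix with polynomial entries; it is evaluated at real points.
\<close>

definition mpoly_at :: "complex poly mat \<Rightarrow> real \<Rightarrow> complex mat" where
  "mpoly_at F x = map_mat (\<lambda>p. poly p (complex_of_real x)) F"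

definition mpoly_deriv :: "complex poly mat \<Rightarrow> complex poly mat" where
  "mpoly_deriv F = map_mat pderiv F"

definition monic_mpoly :: "nat \<Rightarrow> nat \<Rightarrow> complex poly mat \<Rightarrow> bool" where
  "monic_mpoly N n F \<longleftrightarrow>
     F \<in> carrier_mat N N \<and>
     (\<forall>i<N. \<forall>k<N. Polynomial.degree (F $$ (i, k)) \<le> n) \<and>
     map_mat (\<lambda>p. Polynomial.coeff p n) F = 1\<^sub>m N"

definition mvip ::
  "nat \<Rightarrow> (real \<Rightarrow> complex mat) \<Rightarrow> complex poly mat \<Rightarrow> complex poly mat \<Rightarrow> complex mat" where
  "mvip N W F G = mat N N (\<lambda>(i, k).
     LINT y|lborel. (mpoly_at F y * W y * mat_adjoint (mpoly_at G y)) $$ (i, k))"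

text \<open>
  Positive definiteness of the squared norms is not part of the definition: for the weights
  considered here it follows from orthogonality and monicity.
\<close>

definition monic_mvops ::
  "nat \<Rightarrow> (real \<Rightarrow> complex mat) \<Rightarrow> (nat \<Rightarrow> complex poly mat) \<Rightarrow> bool" where
  "monic_mvops N W P \<longleftrightarrow>
     (\<forall>n. monic_mpoly N n (P n)) \<and>
     (\<forall>n m. n \<noteq> m \<longrightarrow> mvip N W (P n) (P m) = 0\<^sub>m N N)"

definition sq_norm ::
  "nat \<Rightarrow> (real \<Rightarrow> complex mat) \<Rightarrow> (nat \<Rightarrow> complex poly mat) \<Rightarrow> nat \<Rightarrow> complex mat" where
  "sq_norm N W P n = mvip N W (P n) (P n)"

definition lowering_relation ::
  "nat \<Rightarrow> (nat \<Rightarrow> complex poly mat) \<Rightarrow> (nat \<Rightarrow> complex mat) \<Rightarrow> bool" where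
  "lowering_relation N P M \<longleftrightarrow>
     (\<forall>n\<ge>2. M n \<in> carrier_mat N N \<and>
       (\<forall>x. mpoly_at (mpoly_deriv (P n)) x =
          of_nat n \<cdot>\<^sub>m mpoly_at (P (n - 1)) x + M n * mpoly_at (P (n - 2)) x))"

text \<open>Meaningful for invertible matrices only; otherwise the value is unspecified.\<close>

definition mat_inv :: "complex mat \<Rightarrow> complex mat" where
  "mat_inv B = the (mat_inverse B)"

end

theory Submission
  imports Defs "HOL-Probability.Distributions"
begin

text \<open>
  Write \<open>W(x) = e\<^sup>-\<^sup>x\<^sup>2 S(x)\<close> with \<open>S = L L\<^sup>*\<close>. Everything rests on the Pearson equation
  \<open>S' = 2 x S - S V\<^sup>*\<close>, in which \<open>V\<close> is a polynomial matrix of degree at most two whose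
  coefficient of \<open>x\<^sup>2\<close> is \<open>A\<close> (\<open>S_poly_pearson\<close>, \<open>mcoeff_V_poly\<close>).

  Given this equation, integration by parts reads \<open>\<langle>F', G\<rangle> = \<langle>F, G V\<rangle> - \<langle>F, G'\<rangle>\<close> (\<open>form_deriv\<close>). Let
  \<open>G\<close> have degree at most \<open>n - 2\<close>, and let \<open>C\<close> be its coefficient of \<open>x\<^sup>n\<^sup>-\<^sup>2\<close>. For \<open>F = P(n)\<close>, the term with \<open>G'\<close>
  vanishes by orthogonality, and \<open>G V\<close> has degree at most \<open>n\<close> and coefficient \<open>C A\<close> there, whence
  \<open>\<langle>P'(n), G\<rangle> = \<H>(n) A\<^sup>* C\<^sup>*\<close> (\<open>form_deriv_P\<close>). On the other hand
  \<open>\<langle>n P(n - 1) + M P(n - 2), G\<rangle> = M \<H>(n - 2) C\<^sup>*\<close>. The difference of \<open>P'(n)\<close> and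
  \<open>n P(n - 1) + M P(n - 2)\<close> has itself degree at most \<open>n - 2\<close>, since the terms of degree \<open>n - 1\<close> cancel; so
  it is zero if and only if \<open>M \<H>(n - 2) = \<H>(n) A\<^sup>*\<close> (\<open>lowering_iff\<close>). As \<open>\<H>(n - 2)\<close> is invertible
  (\<open>det_norm_nonzero\<close>), this gives the existence of the lowering relation and the formula together.

  The Pearson equation comes from the structure of \<open>L\<close>. The generating function of the Hermite
  polynomials shows that \<open>L = exp (x A - A\<^sup>2 / 4)\<close>, so \<open>L' = A L = L A\<close>, and
  \<open>S' = A S + S A\<^sup>* = S (E\<^sup>* + A\<^sup>*)\<close> with \<open>E = L A\<^sup>* L\<^sup>-\<^sup>1\<close>; hence \<open>V = 2 x - E - A\<close>. By the condition on the
  \<open>\<alpha> j\<close> the commutator \<open>[A, A\<^sup>*]\<close> is the diagonal matrix with entries \<open>2 j - N - 1\<close>, so that \<open>A\<close>, \<open>A\<^sup>*\<close>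
  and \<open>[A, A\<^sup>*]\<close> satisfy the commutation relations of \<open>sl\<^sub>2\<close>. Conjugating \<open>A\<^sup>*\<close> by the exponential of a polynomial in \<open>A\<close> then
  stops after the second commutator, which makes \<open>E\<close> quadratic in \<open>x\<close> with coefficient
  \<open>- A\<close> of \<open>x\<^sup>2\<close>. The identity \<open>L A\<^sup>* = E L\<close> is verified entry by entry from the three-term recurrence
  (\<open>hermite_conjugation_identity\<close>, \<open>L_poly_A_adjoint\<close>).
\<close>

section \<open>The Gaussian functional\<close>

text \<open>
  Every integral against the weight is a combination of values of this one linear functional, so
  that orthogonality becomes algebra of polynomial matrices.
\<close>

definition gint :: "complex poly \<Rightarrow> complex" where
  "gint p = (LINT y|lborel. complex_of_real (exp (- (y\<^sup>2))) * poly p (complex_of_real y))"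

text \<open>
  The closed form of the moments gives integrability as well as integration by parts, for
  which it amounts to the recursion between the moments of orders \<open>k + 1\<close> and \<open>k - 1\<close>.
\<close>

lemma gaussian_moment:
  "has_bochner_integral lborel (\<lambda>y::real. exp (- y\<^sup>2) * y ^ k)
     (if even k then sqrt pi * fact k / (2 ^ k * fact (k div 2)) else 0)"
proof (cases "even k")
  case True
  then obtain j where k: "k = 2 * j" by (auto elim: evenE)
  have "has_bochner_integral lborel (\<lambda>y::real. exp (- y\<^sup>2) * y ^ (2 * j))
     (2 *\<^sub>R ((sqrt pi / 2) * (fact (2 * j) / (2 ^ (2 * j) * fact j))))"
    by (rule has_bochner_integral_even_function[OF gaussian_moment_even_pos]) simp
  then show ?thesis by (simp add: k)
next
  case False
  then obtain j where k: "k = 2 * j + 1" by (auto elim: oddE)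
  have "has_bochner_integral lborel (\<lambda>y::real. exp (- y\<^sup>2) * y ^ (2 * j + 1)) 0"
    by (rule has_bochner_integral_odd_function[OF gaussian_moment_odd_pos]) simp
  then show ?thesis by (simp add: k)
qed

lemma integrable_gaussian_poly:
  "integrable lborel (\<lambda>y. complex_of_real (exp (- (y\<^sup>2))) * poly p (complex_of_real y))"
proof -
  have "integrable lborel (\<lambda>y. complex_of_real (exp (- y\<^sup>2) * y ^ i))" for i
    using has_bochner_integral_of_real[OF gaussian_moment] by (rule integrable.intros)
  then have "integrable lborel (\<lambda>y. \<Sum>i\<le>Polynomial.degree p. Polynomial.coeff p i * complex_of_real (exp (- y\<^sup>2) * y ^ i))"
    by (intro Bochner_Integration.integrable_sum integrable_mult_right) auto
  then show ?thesis
    by (simp add: poly_altdef sum_distrib_left mult_ac)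
qed

lemma gint_add: "gint (p + q) = gint p + gint q"
  unfolding gint_def
  by (simp add: ring_distribs integrable_gaussian_poly)

lemma gint_smult: "gint (Polynomial.smult c p) = c * gint p"
proof -
  have "gint (Polynomial.smult c p) =
      (LINT y|lborel. c * (complex_of_real (exp (- (y\<^sup>2))) * poly p (complex_of_real y)))"
    unfolding gint_def by (simp add: mult_ac)
  also have "\<dots> = c * gint p"
    unfolding gint_def by (rule integral_mult_right_zero)
  finally show ?thesis .
qed

lemma gint_0: "gint 0 = 0"
  by (simp add: gint_def)

lemma gint_sum: "gint (sum f I) = (\<Sum>i\<in>I. gint (f i))"
  by (induction I rule: infinite_finite_induct) (simp_all add: gint_0 gint_add)

lemma gint_diff: "gint (p - q) = gint p - gint q"
  using gint_add[of p "Polynomial.smult (-1) q"] gint_smult[of "-1" q] by simp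

lemma gint_monom:
  "gint (monom 1 k) = (if even k then complex_of_real (sqrt pi * fact k / (2 ^ k * fact (k div 2))) else 0)"
  using has_bochner_integral_of_real[OF gaussian_moment[of k], where 'a = complex, THEN has_bochner_integral_integral_eq]
  by (simp add: gint_def poly_monom)

text \<open>
  Integration by parts against \<open>e\<^sup>-\<^sup>x\<^sup>2\<close>, checked on monomials.
\<close>

lemma gint_pderiv: "gint (pderiv p) = gint ([:0, 2:] * p)"
proof -
  have monomial: "gint (pderiv (monom 1 k)) = gint ([:0, 2:] * monom 1 k)" for k
  proof (cases k)
    case 0
    have "[:0, 2:] * monom (1::complex) 0 = Polynomial.smult 2 (monom 1 1)"
      by (simp add: monom_0 monom_Suc)
    then show ?thesis by (simp add: 0 gint_smult gint_monom gint_0 pderiv_monom)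
  next
    case (Suc l)
    have d: "pderiv (monom (1::complex) k) = Polynomial.smult (of_nat k) (monom 1 l)"
      by (simp add: pderiv_monom Suc smult_monom)
    have m: "[:0, 2:] * monom (1::complex) k = Polynomial.smult 2 (monom 1 (Suc (Suc l)))"
      by (simp add: Suc monom_Suc smult_monom)
    have quotient: "(2 * b + 1) * (s * F / (Q * G)) = 2 * (s * ((2 * b + 2) * ((2 * b + 1) * F)) / (4 * Q * ((b + 1) * G)))"
      if "G \<noteq> 0" "Q \<noteq> 0" "b + 1 \<noteq> 0" for b s F Q G :: real
      using that by (simp add: divide_simps)
    have "real (Suc l) * (sqrt pi * fact l / (2 ^ l * fact (l div 2))) =
        2 * (sqrt pi * fact (Suc (Suc l)) / (2 ^ Suc (Suc l) * fact (Suc (l div 2))))" if "even l"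
    proof -
      from that obtain b where l: "l = 2 * b" by (elim evenE)
      show ?thesis
        using quotient[of "fact b" "2 ^ (2 * b)" "real b" "sqrt pi" "fact (2 * b)"]
        by (simp add: l algebra_simps)
    qed
    from arg_cong[OF this, of complex_of_real]
    show ?thesis
      unfolding d m gint_smult gint_monom using Suc by auto
  qed
  have p: "p = (\<Sum>i\<le>Polynomial.degree p. Polynomial.smult (Polynomial.coeff p i) (monom 1 i))"
    by (simp add: smult_monom poly_as_sum_of_monoms)
  have "gint (pderiv p) = (\<Sum>i\<le>Polynomial.degree p. Polynomial.coeff p i * gint (pderiv (monom 1 i)))"
    by (subst p) (simp add: pderiv_sum pderiv_smult gint_sum gint_smult)
  also have "\<dots> = (\<Sum>i\<le>Polynomial.degree p. Polynomial.coeff p i * gint ([:0, 2:] * monom 1 i))"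
    by (simp only: monomial)
  also have "\<dots> = gint (\<Sum>i\<le>Polynomial.degree p. [:0, 2:] * Polynomial.smult (Polynomial.coeff p i) (monom 1 i))"
    by (simp add: gint_sum gint_smult mult_smult_right del: mult_pCons_left)
  also have "\<dots> = gint ([:0, 2:] * p)"
    by (subst (2) p) (simp only: sum_distrib_left)
  finally show ?thesis .
qed

text \<open>
  The integrand is \<open>e\<^sup>-\<^sup>x\<^sup>2 \<Sum>|q i|\<^sup>2\<close>. If its integral vanishes, each \<open>q i\<close> is zero almost everywhere,
  while a nonzero polynomial has only finitely many zeros.
\<close>

lemma gint_definite:
  assumes "finite I" and "gint (\<Sum>i\<in>I. q i * map_poly cnj (q i)) = 0" and "i \<in> I"
  shows "q i = 0"
proof (rule ccontr)
  assume "q i \<noteq> 0"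
  define f where "f y = (\<Sum>i\<in>I. exp (- (y\<^sup>2)) * (norm (poly (q i) (complex_of_real y)))\<^sup>2)" for y :: real
  have of_f: "complex_of_real (f y) =
      complex_of_real (exp (- (y\<^sup>2))) * poly (\<Sum>i\<in>I. q i * map_poly cnj (q i)) (complex_of_real y)" for y
    by (simp add: f_def poly_sum sum_distrib_left complex_norm_square[symmetric] flip: of_real_mult of_real_power)
  have "integrable lborel (\<lambda>y. complex_of_real (f y))"
    unfolding of_f by (rule integrable_gaussian_poly)
  then have int_f: "integrable lborel f"
    by (simp only: complex_of_real_integrable_eq)
  have "complex_of_real (LINT y|lborel. f y) = 0"
    using assms(2) by (simp only: gint_def flip: of_f integral_complex_of_real)
  then have int_0: "(LINT y|lborel. f y) = 0"
    by (simp only: of_real_eq_0_iff)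
  have "AE y in lborel. f y = 0"
    by (rule iffD1[OF integral_nonneg_eq_0_iff_AE[OF int_f] int_0]) (simp add: f_def sum_nonneg)
  moreover have "finite {y. poly (q i) (complex_of_real y) = 0}"
    using finite_vimageI[OF poly_roots_finite[OF \<open>q i \<noteq> 0\<close>], of complex_of_real]
    by (simp add: vimage_def inj_on_def)
  then have "AE y in lborel. y \<notin> {y. poly (q i) (complex_of_real y) = 0}"
    by (intro AE_not_in finite_imp_null_set_lborel)
  ultimately have "AE y::real in lborel. False"
  proof eventually_elim
    case (elim y)
    have "exp (- (y\<^sup>2)) * (norm (poly (q i) (complex_of_real y)))\<^sup>2 = 0"
      using elim(1) assms(1,3) unfolding f_def by (subst (asm) sum_nonneg_eq_0_iff) auto
    with elim(2) show False by simp
  qed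
  then show False
    by (simp add: eventually_False ae_filter_eq_bot_iff)
qed

section \<open>Complex matrices\<close>

declare minus_carrier_mat [simp]

lemma square_mult_carrier [simp, intro]:
  "X \<in> carrier_mat n n \<Longrightarrow> Y \<in> carrier_mat n n \<Longrightarrow> X * Y \<in> carrier_mat n n"
  by (rule mult_carrier_mat)

lemma mat_adjoint_index [simp]:
  "dim_row (mat_adjoint C) = dim_col C" "dim_col (mat_adjoint C) = dim_row C"
  "i < dim_col C \<Longrightarrow> k < dim_row C \<Longrightarrow> mat_adjoint C $$ (i, k) = conjugate (C $$ (k, i))"
  by (auto simp: mat_adjoint_def mat_of_rows_index)

lemma mat_adjoint_carrier: "C \<in> carrier_mat m n \<Longrightarrow> mat_adjoint C \<in> carrier_mat n m"
  by (metis carrier_matD carrier_matI mat_adjoint_index(1,2))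

lemma mult_mat_index:
  assumes "X \<in> carrier_mat l m" "Y \<in> carrier_mat m n" "i < l" "k < n"
  shows "(X * Y) $$ (i, k) = (\<Sum>j<m. X $$ (i, j) * Y $$ (j, k))"
  using assms by (auto simp: scalar_prod_def atLeast0LessThan intro!: sum.cong)

lemma mat_adjoint_mult:
  fixes X Y :: "complex mat"
  assumes "X \<in> carrier_mat l m" "Y \<in> carrier_mat m n"
  shows "mat_adjoint (X * Y) = mat_adjoint Y * mat_adjoint X"
  by (rule eq_matI) (use assms in \<open>auto simp: scalar_prod_def mult.commute intro!: sum.cong\<close>)

lemma mat_adjoint_one: "mat_adjoint (1\<^sub>m n) = (1\<^sub>m n :: complex mat)"
  by (rule eq_matI) auto

text \<open>
  A nonzero row vector in the left kernel, repeated in all rows, is a nonzero square matrix that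
  annihilates \<open>X\<close> from the left.
\<close>

lemma det_nonzero_if_left_kernel_trivial:
  fixes X :: "complex mat"
  assumes "X \<in> carrier_mat n n" and "\<And>C. C \<in> carrier_mat n n \<Longrightarrow> C * X = 0\<^sub>m n n \<Longrightarrow> C = 0\<^sub>m n n"
  shows "det X \<noteq> 0"
proof
  assume "det X = 0"
  then have "det (transpose_mat X) = 0" using det_transpose[OF assms(1)] by simp
  then obtain v where v: "v \<in> carrier_vec n" "v \<noteq> 0\<^sub>v n" "transpose_mat X *\<^sub>v v = 0\<^sub>v n"
    using det_0_iff_vec_prod_zero_field[of "transpose_mat X" n] assms(1) by auto
  define C where "C = mat n n (\<lambda>(i, k). vec_index v k)"
  have C: "C \<in> carrier_mat n n" by (simp add: C_def)
  have "C * X = 0\<^sub>m n n"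
  proof (rule eq_matI)
    fix i k assume "i < dim_row (0\<^sub>m n n :: complex mat)" "k < dim_col (0\<^sub>m n n :: complex mat)"
    then have ik: "i < n" "k < n" by auto
    have "(C * X) $$ (i, k) = vec_index (transpose_mat X *\<^sub>v v) k"
      using ik assms(1) v(1) by (auto simp: C_def scalar_prod_def mult.commute intro!: sum.cong)
    then show "(C * X) $$ (i, k) = 0\<^sub>m n n $$ (i, k)" using ik v(3) by simp
  qed (use assms(1) C in auto)
  from assms(2)[OF C this] have "C = 0\<^sub>m n n" .
  have "vec_index v k = 0" if "k < n" for k
    using arg_cong[OF \<open>C = 0\<^sub>m n n\<close>, of "\<lambda>Y. Y $$ (k, k)"] that by (simp add: C_def)
  then have "v = 0\<^sub>v n" using v(1) by (intro eq_vecI) auto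
  with v(2) show False by simp
qed

lemma mat_inv_inverse:
  assumes "X \<in> carrier_mat n n" "det X \<noteq> 0"
  shows "mat_inv X \<in> carrier_mat n n" "X * mat_inv X = 1\<^sub>m n" "mat_inv X * X = 1\<^sub>m n"
proof -
  have "mat_inverse X \<noteq> None"
    using mat_inverse(1)[OF assms(1), where b = "()"] det_non_zero_imp_unit[OF assms, where b = "()"] by blast
  then obtain Y where "mat_inverse X = Some Y" by blast
  with mat_inverse(2)[OF assms(1) this]
  show "mat_inv X \<in> carrier_mat n n" "X * mat_inv X = 1\<^sub>m n" "mat_inv X * X = 1\<^sub>m n"
    by (auto simp: mat_inv_def)
qed

lemma mat_eq_add_diff_addD:
  fixes X L Y R D :: "'a :: ab_group_add mat"
  assumes "X \<in> carrier_mat m n" "L \<in> carrier_mat m n" "Y \<in> carrier_mat m n" "R \<in> carrier_mat m n"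
    "D \<in> carrier_mat m n" and "X = L + (Y - R) + D"
  shows "L = (X - Y) + (R - D)"
  by (rule eq_matI) (use assms in auto)

lemma mat_diff_eq_zero_iff:
  fixes X Y :: "'a :: ab_group_add mat"
  assumes "X \<in> carrier_mat m n" "Y \<in> carrier_mat m n"
  shows "X - Y = 0\<^sub>m m n \<longleftrightarrow> X = Y"
proof
  assume diff: "X - Y = 0\<^sub>m m n"
  show "X = Y"
  proof (rule eq_matI)
    fix i k assume "i < dim_row Y" "k < dim_col Y"
    then show "X $$ (i, k) = Y $$ (i, k)"
      using arg_cong[OF diff, of "\<lambda>Z. Z $$ (i, k)"] assms by simp
  qed (use assms in auto)
qed (use assms in auto)

lemma mat_diff_zero:
  fixes X :: "'a :: ab_group_add mat"
  shows "X \<in> carrier_mat m n \<Longrightarrow> X - 0\<^sub>m m n = X"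
  by (rule eq_matI) auto

lemma mat_diff_diff_eq:
  fixes X Y Z :: "'a :: ab_group_add mat"
  assumes "X \<in> carrier_mat m n" "Y \<in> carrier_mat m n" "Z \<in> carrier_mat m n"
  shows "X - Y - Z = X - (Y + Z)"
  by (rule eq_matI) (use assms in auto)

lemma mat_add_eq_diff_diff:
  fixes X Y Z :: "'a :: ab_group_add mat"
  assumes "X \<in> carrier_mat m n" "Y \<in> carrier_mat m n" "Z \<in> carrier_mat m n"
  shows "Y + Z = X - (X - Y - Z)"
  by (rule eq_matI) (use assms in auto)

section \<open>Matrix polynomials\<close>

definition const_mpoly :: "complex mat \<Rightarrow> complex poly mat" where
  "const_mpoly C = map_mat (\<lambda>c. [:c:]) C"

text \<open>
  Conjugating the coefficients gives the pointwise adjoint on the real line.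
\<close>

definition mpoly_adjoint :: "complex poly mat \<Rightarrow> complex poly mat" where
  "mpoly_adjoint F = transpose_mat (map_mat (map_poly cnj) F)"

text \<open>
  Together with \<open>mdegree_le\<close>, the coefficient matrices replace the leading coefficient of a matrix
  polynomial: the degree bound may exceed the degree, in which case the coefficient at the
  bound is the zero matrix.
\<close>

definition mcoeff :: "nat \<Rightarrow> complex poly mat \<Rightarrow> complex mat" where
  "mcoeff n F = map_mat (\<lambda>p. Polynomial.coeff p n) F"

definition mdegree_le :: "nat \<Rightarrow> complex poly mat \<Rightarrow> bool" where
  "mdegree_le n F \<longleftrightarrow> (\<forall>i<dim_row F. \<forall>k<dim_col F. Polynomial.degree (F $$ (i, k)) \<le> n)"

lemma const_mpoly_carrier [simp]: "const_mpoly C \<in> carrier_mat m n \<longleftrightarrow> C \<in> carrier_mat m n"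
  by (simp add: const_mpoly_def)

lemma mpoly_adjoint_carrier [simp]: "mpoly_adjoint F \<in> carrier_mat n m \<longleftrightarrow> F \<in> carrier_mat m n"
  by (auto simp: mpoly_adjoint_def)

lemma mcoeff_carrier [simp]: "mcoeff k F \<in> carrier_mat m n \<longleftrightarrow> F \<in> carrier_mat m n"
  by (simp add: mcoeff_def)

lemma mpoly_deriv_carrier [simp]: "mpoly_deriv F \<in> carrier_mat m n \<longleftrightarrow> F \<in> carrier_mat m n"
  by (simp add: mpoly_deriv_def)

lemma map_poly_cnj_mult: "map_poly cnj (p * q) = map_poly cnj p * map_poly cnj q"
  by (rule poly_eqI) (simp add: coeff_map_poly coeff_mult)

lemma map_poly_cnj_add: "map_poly cnj (p + q) = map_poly cnj p + map_poly cnj q"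
  by (rule poly_eqI) (simp add: coeff_map_poly)

lemma map_poly_cnj_diff: "map_poly cnj (p - q) = map_poly cnj p - map_poly cnj q"
  by (rule poly_eqI) (simp add: coeff_map_poly)

lemma map_poly_cnj_sum: "map_poly cnj (sum f I) = (\<Sum>i\<in>I. map_poly cnj (f i))"
  by (induction I rule: infinite_finite_induct) (simp_all add: map_poly_cnj_add)

lemma mpoly_adjoint_mult:
  assumes "F \<in> carrier_mat l m" "G \<in> carrier_mat m n"
  shows "mpoly_adjoint (F * G) = mpoly_adjoint G * mpoly_adjoint F"
proof (rule eq_matI)
  fix i k assume "i < dim_row (mpoly_adjoint G * mpoly_adjoint F)"
    "k < dim_col (mpoly_adjoint G * mpoly_adjoint F)"
  then show "mpoly_adjoint (F * G) $$ (i, k) = (mpoly_adjoint G * mpoly_adjoint F) $$ (i, k)"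
    using assms
    by (auto simp: mpoly_adjoint_def scalar_prod_def map_poly_cnj_sum map_poly_cnj_mult mult.commute intro!: sum.cong)
qed (use assms in \<open>auto simp: mpoly_adjoint_def\<close>)

lemma mpoly_adjoint_add:
  assumes "F \<in> carrier_mat m n" "G \<in> carrier_mat m n"
  shows "mpoly_adjoint (F + G) = mpoly_adjoint F + mpoly_adjoint G"
  by (rule eq_matI) (use assms in \<open>auto simp: mpoly_adjoint_def map_poly_cnj_add\<close>)

lemma mpoly_adjoint_zero: "mpoly_adjoint (0\<^sub>m m n) = 0\<^sub>m n m"
  by (rule eq_matI) (auto simp: mpoly_adjoint_def)

lemma mpoly_adjoint_deriv: "mpoly_adjoint (mpoly_deriv F) = mpoly_deriv (mpoly_adjoint F)"
  by (rule eq_matI)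
    (auto simp: mpoly_adjoint_def mpoly_deriv_def coeff_map_poly coeff_pderiv intro!: poly_eqI)

lemma mpoly_adjoint_const: "mpoly_adjoint (const_mpoly C) = const_mpoly (mat_adjoint C)"
  by (rule eq_matI) (auto simp: mpoly_adjoint_def const_mpoly_def)

lemma mpoly_at_carrier [simp]: "mpoly_at F x \<in> carrier_mat m n \<longleftrightarrow> F \<in> carrier_mat m n"
  by (simp add: mpoly_at_def)

lemma mpoly_at_mult:
  assumes "F \<in> carrier_mat l m" "G \<in> carrier_mat m n"
  shows "mpoly_at (F * G) x = mpoly_at F x * mpoly_at G x"
  by (rule eq_matI) (use assms in \<open>auto simp: mpoly_at_def scalar_prod_def poly_sum\<close>)

lemma mpoly_at_adjoint: "mpoly_at (mpoly_adjoint F) x = mat_adjoint (mpoly_at F x)"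
  by (rule eq_matI) (auto simp: mpoly_at_def mpoly_adjoint_def)

text \<open>
  The entries are polynomials that agree on the infinite set of real numbers.
\<close>

lemma mpoly_at_inject:
  assumes "F \<in> carrier_mat m n" "G \<in> carrier_mat m n" and "\<And>x. mpoly_at F x = mpoly_at G x"
  shows "F = G"
proof (rule eq_matI)
  fix i k assume ik: "i < dim_row G" "k < dim_col G"
  have "poly (F $$ (i, k) - G $$ (i, k)) (complex_of_real x) = 0" for x
    using arg_cong[OF assms(3)[of x], of "\<lambda>X. X $$ (i, k)"] ik assms(1,2)
    by (simp add: mpoly_at_def)
  then have "range complex_of_real \<subseteq> {z. poly (F $$ (i, k) - G $$ (i, k)) z = 0}"
    by auto
  moreover have "infinite (range complex_of_real)"
    using infinite_UNIV_char_0 finite_imageD[of complex_of_real UNIV] by (auto simp: inj_on_def)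
  ultimately have "F $$ (i, k) - G $$ (i, k) = 0"
    using poly_roots_finite finite_subset by blast
  then show "F $$ (i, k) = G $$ (i, k)" by simp
qed (use assms in auto)

lemma mdegree_le_mult:
  assumes "F \<in> carrier_mat l m" "G \<in> carrier_mat m n" "mdegree_le a F" "mdegree_le b G"
  shows "mdegree_le (a + b) (F * G)"
  unfolding mdegree_le_def
proof (intro allI impI)
  fix i k assume "i < dim_row (F * G)" "k < dim_col (F * G)"
  then have ik: "i < l" "k < n" using assms by auto
  show "Polynomial.degree ((F * G) $$ (i, k)) \<le> a + b"
    unfolding mult_mat_index[OF assms(1,2) ik]
    using assms ik
    by (intro degree_sum_le order_trans[OF degree_mult_le] add_mono) (auto simp: mdegree_le_def)
qed

lemma coeff_mult_at_bounds:
  assumes "Polynomial.degree p \<le> a" "Polynomial.degree q \<le> b"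
  shows "Polynomial.coeff (p * q) (a + b) = Polynomial.coeff p a * Polynomial.coeff q b"
proof -
  have "Polynomial.coeff p i * Polynomial.coeff q (a + b - i) =
      (if i = a then Polynomial.coeff p a * Polynomial.coeff q b else 0)" if "i \<le> a + b" for i
    using that assms coeff_eq_0[of p i] coeff_eq_0[of q "a + b - i"] by (cases "i < a") auto
  then show ?thesis by (simp add: coeff_mult)
qed

lemma mcoeff_mult:
  assumes "F \<in> carrier_mat l m" "G \<in> carrier_mat m n" "mdegree_le a F" "mdegree_le b G"
  shows "mcoeff (a + b) (F * G) = mcoeff a F * mcoeff b G"
proof (rule eq_matI)
  fix i k assume "i < dim_row (mcoeff a F * mcoeff b G)" "k < dim_col (mcoeff a F * mcoeff b G)"
  then have ik: "i < l" "k < n" using assms by (auto simp: mcoeff_def)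
  have "mcoeff a F \<in> carrier_mat l m" "mcoeff b G \<in> carrier_mat m n" using assms by auto
  from mult_mat_index[OF this ik]
  show "mcoeff (a + b) (F * G) $$ (i, k) = (mcoeff a F * mcoeff b G) $$ (i, k)"
    using assms ik mult_mat_index[OF assms(1,2) ik]
    by (auto simp: mcoeff_def coeff_sum mdegree_le_def coeff_mult_at_bounds intro!: sum.cong)
qed (use assms in \<open>auto simp: mcoeff_def\<close>)

lemma mdegree_le_mono: "mdegree_le a F \<Longrightarrow> a \<le> b \<Longrightarrow> mdegree_le b F"
  unfolding mdegree_le_def by (meson order_trans)

lemma mdegree_le_const [simp]: "mdegree_le a (const_mpoly C)"
  by (auto simp: mdegree_le_def const_mpoly_def)

lemma mdegree_le_diff:
  assumes "F \<in> carrier_mat m n" "G \<in> carrier_mat m n" "mdegree_le a F" "mdegree_le a G"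
  shows "mdegree_le a (F - G)"
  using assms by (auto simp: mdegree_le_def intro!: degree_diff_le)

lemma mdegree_le_deriv: "mdegree_le (Suc a) F \<Longrightarrow> mdegree_le a (mpoly_deriv F)"
  by (simp add: mdegree_le_def mpoly_deriv_def degree_pderiv) (simp add: le_diff_conv)

text \<open>
  A degree bound drops by one when the coefficient at the bound vanishes. This drives the
  expansions in the orthogonal polynomials by descending degree.
\<close>

lemma mdegree_le_lower:
  assumes "F \<in> carrier_mat m n" "mdegree_le (Suc a) F" "mcoeff (Suc a) F = 0\<^sub>m m n"
  shows "mdegree_le a F"
  unfolding mdegree_le_def
proof (intro allI impI)
  fix i k assume ik: "i < dim_row F" "k < dim_col F"
  then have "mcoeff (Suc a) F $$ (i, k) = 0" using assms by auto
  then have "Polynomial.coeff (F $$ (i, k)) (Suc a) = 0" using ik by (simp add: mcoeff_def)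
  moreover have "Polynomial.degree (F $$ (i, k)) \<le> Suc a"
    using assms ik by (simp add: mdegree_le_def)
  ultimately show "Polynomial.degree (F $$ (i, k)) \<le> a"
    by (metis le_SucE leading_coeff_0_iff degree_0 le0)
qed

lemma mcoeff_diff:
  assumes "F \<in> carrier_mat m n" "G \<in> carrier_mat m n"
  shows "mcoeff k (F - G) = mcoeff k F - mcoeff k G"
  by (rule eq_matI) (use assms in \<open>auto simp: mcoeff_def\<close>)

lemma mcoeff_const_mult:
  assumes "C \<in> carrier_mat l m" "F \<in> carrier_mat m n"
  shows "mcoeff k (const_mpoly C * F) = C * mcoeff k F"
proof (rule eq_matI)
  fix i j assume "i < dim_row (C * mcoeff k F)" "j < dim_col (C * mcoeff k F)"
  then have ij: "i < l" "j < n" using assms by (auto simp: mcoeff_def)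
  have "const_mpoly C \<in> carrier_mat l m" "mcoeff k F \<in> carrier_mat m n" using assms by auto
  note index = mult_mat_index[OF this(1) assms(2) ij] mult_mat_index[OF assms(1) this(2) ij]
  have "mcoeff k (const_mpoly C * F) $$ (i, j) = Polynomial.coeff ((const_mpoly C * F) $$ (i, j)) k"
    using assms ij by (simp add: mcoeff_def)
  then show "mcoeff k (const_mpoly C * F) $$ (i, j) = (C * mcoeff k F) $$ (i, j)"
    unfolding index using assms ij by (simp add: coeff_sum const_mpoly_def mcoeff_def)
qed (use assms in \<open>auto simp: mcoeff_def const_mpoly_def\<close>)

lemma mpoly_deriv_mult:
  assumes "F \<in> carrier_mat l m" "G \<in> carrier_mat m n"
  shows "mpoly_deriv (F * G) = mpoly_deriv F * G + F * mpoly_deriv G"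
proof (rule eq_matI)
  fix i k assume "i < dim_row (mpoly_deriv F * G + F * mpoly_deriv G)"
    "k < dim_col (mpoly_deriv F * G + F * mpoly_deriv G)"
  then have ik: "i < l" "k < n" using assms by (auto simp: mpoly_deriv_def)
  have "mpoly_deriv F \<in> carrier_mat l m" "mpoly_deriv G \<in> carrier_mat m n" using assms by auto
  note index = mult_mat_index[OF assms ik] mult_mat_index[OF this(1) assms(2) ik]
    mult_mat_index[OF assms(1) this(2) ik]
  have "mpoly_deriv (F * G) $$ (i, k) = pderiv ((F * G) $$ (i, k))"
    using assms ik by (simp add: mpoly_deriv_def)
  also have "\<dots> = (\<Sum>j<m. mpoly_deriv F $$ (i, j) * G $$ (j, k)) + (\<Sum>j<m. F $$ (i, j) * mpoly_deriv G $$ (j, k))"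
    unfolding index using assms ik
    by (simp add: pderiv_sum pderiv_mult sum.distrib mpoly_deriv_def mult.commute add.commute)
  also have "\<dots> = (mpoly_deriv F * G + F * mpoly_deriv G) $$ (i, k)"
    using assms ik by (simp add: index[symmetric] del: index_mult_mat(1))
  finally show "mpoly_deriv (F * G) $$ (i, k) = (mpoly_deriv F * G + F * mpoly_deriv G) $$ (i, k)" .
qed (use assms in \<open>auto simp: mpoly_deriv_def\<close>)

lemma mdegree_le_0_eq_zero:
  assumes "F \<in> carrier_mat m n" "mdegree_le 0 F" "mcoeff 0 F = 0\<^sub>m m n"
  shows "F = 0\<^sub>m m n"
proof (rule eq_matI)
  fix i k assume ik: "i < dim_row (0\<^sub>m m n :: complex poly mat)" "k < dim_col (0\<^sub>m m n :: complex poly mat)"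
  have "mcoeff 0 F $$ (i, k) = 0" using assms(3) ik by simp
  then have "Polynomial.coeff (F $$ (i, k)) 0 = 0" using ik assms(1) by (simp add: mcoeff_def)
  moreover have "Polynomial.degree (F $$ (i, k)) = 0" using assms ik by (simp add: mdegree_le_def)
  ultimately show "F $$ (i, k) = 0\<^sub>m m n $$ (i, k)" using ik
    by (metis index_zero_mat leading_coeff_0_iff)
qed (use assms in auto)

lemma mdegree_le_const_mult:
  assumes "C \<in> carrier_mat l m" "F \<in> carrier_mat m n" "mdegree_le a F"
  shows "mdegree_le a (const_mpoly C * F)"
  using mdegree_le_mult[of "const_mpoly C" l m F n 0 a] assms by simp

lemma mcoeff_above_degree:
  assumes "F \<in> carrier_mat m n" "mdegree_le a F" "a < b"
  shows "mcoeff b F = 0\<^sub>m m n"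
  by (rule eq_matI) (use assms in \<open>auto simp: mcoeff_def mdegree_le_def intro!: coeff_eq_0 le_less_trans[of _ a b]\<close>)

lemma mcoeff_deriv: "mcoeff k (mpoly_deriv F) = of_nat (Suc k) \<cdot>\<^sub>m mcoeff (Suc k) F"
  by (rule eq_matI) (auto simp: mcoeff_def mpoly_deriv_def coeff_pderiv)

definition mgint :: "complex poly mat \<Rightarrow> complex mat" where
  "mgint F = map_mat gint F"

lemma mgint_carrier [simp]: "mgint F \<in> carrier_mat m n \<longleftrightarrow> F \<in> carrier_mat m n"
  by (simp add: mgint_def)

lemma mgint_zero: "mgint (0\<^sub>m m n) = 0\<^sub>m m n"
  by (rule eq_matI) (auto simp: mgint_def gint_0)

lemma mgint_add:
  assumes "F \<in> carrier_mat m n" "G \<in> carrier_mat m n"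
  shows "mgint (F + G) = mgint F + mgint G"
  by (rule eq_matI) (use assms in \<open>auto simp: mgint_def gint_add\<close>)

lemma mgint_diff:
  assumes "F \<in> carrier_mat m n" "G \<in> carrier_mat m n"
  shows "mgint (F - G) = mgint F - mgint G"
  by (rule eq_matI) (use assms in \<open>auto simp: mgint_def gint_diff\<close>)

lemma mgint_const_left:
  assumes "C \<in> carrier_mat l m" "F \<in> carrier_mat m n"
  shows "mgint (const_mpoly C * F) = C * mgint F"
  by (rule eq_matI) (use assms in \<open>auto simp: mgint_def const_mpoly_def scalar_prod_def gint_sum gint_smult\<close>)

lemma mgint_const_right:
  assumes "F \<in> carrier_mat l m" "C \<in> carrier_mat m n"
  shows "mgint (F * const_mpoly C) = mgint F * C"
  by (rule eq_matI)
    (use assms in \<open>auto simp: mgint_def const_mpoly_def scalar_prod_def gint_sum gint_smult mult.commute\<close>)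

lemma mgint_deriv: "mgint (mpoly_deriv F) = mgint ([:0, 2:] \<cdot>\<^sub>m F)"
  by (rule eq_matI) (auto simp: mgint_def mpoly_deriv_def gint_pderiv simp del: mult_pCons_left)

text \<open>
  A diagonal entry of \<open>F F\<^sup>*\<close> is a sum of squared moduli over a row of \<open>F\<close>.
\<close>

lemma mgint_definite:
  assumes "F \<in> carrier_mat m n" "mgint (F * mpoly_adjoint F) = 0\<^sub>m m m"
  shows "F = 0\<^sub>m m n"
proof (rule eq_matI)
  fix i k assume "i < dim_row (0\<^sub>m m n :: complex poly mat)" "k < dim_col (0\<^sub>m m n :: complex poly mat)"
  then have ik: "i < m" "k < n" by auto
  have "mpoly_adjoint F \<in> carrier_mat n m" using assms(1) by simp
  from mult_mat_index[OF assms(1) this ik(1) ik(1)]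
  have "mgint (F * mpoly_adjoint F) $$ (i, i) = gint (\<Sum>j<n. F $$ (i, j) * map_poly cnj (F $$ (i, j)))"
    using assms(1) ik by (simp add: mgint_def mpoly_adjoint_def)
  then have "gint (\<Sum>j<n. F $$ (i, j) * map_poly cnj (F $$ (i, j))) = 0"
    using assms(2) ik by simp
  from gint_definite[OF _ this, of k] ik show "F $$ (i, k) = 0\<^sub>m m n $$ (i, k)" by simp
qed (use assms in auto)

section \<open>Orthogonal polynomials for a weight with a Pearson equation\<close>

text \<open>
  The lowering relation depends on the weight \<open>e\<^sup>-\<^sup>x\<^sup>2 S(x)\<close> only through the Pearson equation
  \<open>S' = 2 x S - S V\<^sup>*\<close>, with \<open>V\<close> a polynomial matrix of degree at most two, and through definiteness. The
  coefficient matrix of \<open>x\<^sup>2\<close> in \<open>V\<close> is what appears in the final formula.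
\<close>

locale gaussian_mvops =
  fixes N :: nat and S V :: "complex poly mat" and P :: "nat \<Rightarrow> complex poly mat"
  assumes S_carrier [simp]: "S \<in> carrier_mat N N"
    and V_carrier [simp]: "V \<in> carrier_mat N N"
    and pearson: "mpoly_deriv S = [:0, 2:] \<cdot>\<^sub>m S - S * mpoly_adjoint V"
    and V_degree: "mdegree_le 2 V"
    and definite: "\<And>F. F \<in> carrier_mat N N \<Longrightarrow> mgint (F * S * mpoly_adjoint F) = 0\<^sub>m N N \<Longrightarrow> F = 0\<^sub>m N N"
    and P_carrier [simp]: "\<And>n. P n \<in> carrier_mat N N"
    and P_degree: "\<And>n. mdegree_le n (P n)"
    and P_monic: "\<And>n. mcoeff n (P n) = 1\<^sub>m N"
    and P_orthogonal: "\<And>n m. n \<noteq> m \<Longrightarrow> mgint (P n * S * mpoly_adjoint (P m)) = 0\<^sub>m N N"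
begin

definition form :: "complex poly mat \<Rightarrow> complex poly mat \<Rightarrow> complex mat" where
  "form F G = mgint (F * S * mpoly_adjoint G)"

lemma P_dim [simp]: "dim_row (P n) = N" "dim_col (P n) = N"
  by (rule carrier_matD[OF P_carrier])+

lemma adjoint_carrier [simp, intro]:
  "(C :: complex mat) \<in> carrier_mat N N \<Longrightarrow> mat_adjoint C \<in> carrier_mat N N"
  by (rule mat_adjoint_carrier)

lemma form_carrier [simp, intro]:
  "F \<in> carrier_mat N N \<Longrightarrow> G \<in> carrier_mat N N \<Longrightarrow> form F G \<in> carrier_mat N N"
  by (simp add: form_def)

lemma form_diff_left:
  assumes F: "F \<in> carrier_mat N N" and G: "G \<in> carrier_mat N N" and H: "H \<in> carrier_mat N N"
  shows "form (F - G) H = form F H - form G H"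
proof -
  have "(F - G) * S * mpoly_adjoint H = F * S * mpoly_adjoint H - G * S * mpoly_adjoint H"
    using F G H by (simp add: minus_mult_distrib_mat[of _ N N _ _ N])
  then show ?thesis using F G H by (simp add: form_def mgint_diff[of _ N N])
qed

lemma form_add_right:
  assumes F: "F \<in> carrier_mat N N" and G: "G \<in> carrier_mat N N" and H: "H \<in> carrier_mat N N"
  shows "form F (G + H) = form F G + form F H"
proof -
  have "F * S * mpoly_adjoint (G + H) = F * S * mpoly_adjoint G + F * S * mpoly_adjoint H"
    using F G H by (simp add: mpoly_adjoint_add[of _ N N] mult_add_distrib_mat[of _ N N _ N])
  then show ?thesis using F G H by (simp add: form_def mgint_add[of _ N N])
qed

lemma form_const_left:
  assumes C: "C \<in> carrier_mat N N" and F: "F \<in> carrier_mat N N" and G: "G \<in> carrier_mat N N"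
  shows "form (const_mpoly C * F) G = C * form F G"
proof -
  have "const_mpoly C * F * S * mpoly_adjoint G = const_mpoly C * (F * S * mpoly_adjoint G)"
    using F G C by (simp add: assoc_mult_mat[of _ N N _ N _ N])
  then show ?thesis using F G C by (simp add: form_def mgint_const_left[of _ N N _ N])
qed

lemma form_const_right:
  assumes C: "C \<in> carrier_mat N N" and F: "F \<in> carrier_mat N N" and G: "G \<in> carrier_mat N N"
  shows "form F (const_mpoly C * G) = form F G * mat_adjoint C"
proof -
  have "F * S * mpoly_adjoint (const_mpoly C * G) = F * S * mpoly_adjoint G * const_mpoly (mat_adjoint C)"
    using F G C
    by (simp add: mpoly_adjoint_mult[of _ N N _ N] mpoly_adjoint_const assoc_mult_mat[of _ N N _ N _ N])
  then show ?thesis using F G C by (simp add: form_def mgint_const_right[of _ N N _ N])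
qed

text \<open>
  Integration by parts: the derivative of \<open>F S G\<^sup>*\<close> has the same Gaussian integral as \<open>2 x F S G\<^sup>*\<close>,
  and this term is cancelled by the one that the Pearson equation produces in \<open>F S' G\<^sup>*\<close>.
\<close>

lemma form_deriv:
  assumes F: "F \<in> carrier_mat N N" and G: "G \<in> carrier_mat N N"
  shows "form (mpoly_deriv F) G = form F (G * V) - form F (mpoly_deriv G)"
proof -
  let ?X = "F * S * mpoly_adjoint G"
  let ?L = "mpoly_deriv F * S * mpoly_adjoint G"
  let ?R = "F * S * mpoly_adjoint (G * V)" and ?D = "F * S * mpoly_adjoint (mpoly_deriv G)"
  have [simp]: "?X \<in> carrier_mat N N" "?L \<in> carrier_mat N N" "?R \<in> carrier_mat N N" "?D \<in> carrier_mat N N"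
    using F G by auto
  have R: "?R = F * (S * mpoly_adjoint V) * mpoly_adjoint G"
    using F G by (simp add: mpoly_adjoint_mult[of _ N N _ N] assoc_mult_mat[of _ N N _ N _ N])
  have FS: "F * mpoly_deriv S = [:0, 2:] \<cdot>\<^sub>m (F * S) - F * (S * mpoly_adjoint V)"
    using F by (simp add: pearson mult_minus_distrib_mat[of _ N N _ N] mult_smult_distrib[of _ N N _ N])
  have "mpoly_deriv ?X = mpoly_deriv (F * S) * mpoly_adjoint G + F * S * mpoly_deriv (mpoly_adjoint G)"
    using F G by (intro mpoly_deriv_mult[of _ N N _ N]) auto
  also have "mpoly_deriv (F * S) = mpoly_deriv F * S + F * mpoly_deriv S"
    using F by (intro mpoly_deriv_mult[of _ N N _ N]) auto
  also have "(mpoly_deriv F * S + F * mpoly_deriv S) * mpoly_adjoint G = ?L + ([:0, 2:] \<cdot>\<^sub>m ?X - ?R)"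
    unfolding FS R
    using F G by (simp add: add_mult_distrib_mat[of _ N N _ _ N] minus_mult_distrib_mat[of _ N N _ _ N]
        mult_smult_assoc_mat[of _ N N _ N])
  finally have "mpoly_deriv ?X = ?L + ([:0, 2:] \<cdot>\<^sub>m ?X - ?R) + ?D"
    by (simp add: mpoly_adjoint_deriv)
  then have "?L = (mpoly_deriv ?X - [:0, 2:] \<cdot>\<^sub>m ?X) + (?R - ?D)"
    by (rule mat_eq_add_diff_addD[of _ N N, rotated -1]) simp_all
  then have "mgint ?L = (mgint (mpoly_deriv ?X) - mgint ([:0, 2:] \<cdot>\<^sub>m ?X)) + (mgint ?R - mgint ?D)"
    by (simp add: mgint_add[of _ N N] mgint_diff[of _ N N])
  also have "mgint (mpoly_deriv ?X) - mgint ([:0, 2:] \<cdot>\<^sub>m ?X) = 0\<^sub>m N N"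
    by (simp add: mgint_deriv)
  finally show ?thesis
    by (simp add: form_def)
qed

lemma form_zero_left: "G \<in> carrier_mat N N \<Longrightarrow> form (0\<^sub>m N N) G = 0\<^sub>m N N"
  by (simp add: form_def left_mult_zero_mat[of _ N N] mgint_zero)

lemma form_zero_right: "F \<in> carrier_mat N N \<Longrightarrow> form F (0\<^sub>m N N) = 0\<^sub>m N N"
  by (simp add: form_def mpoly_adjoint_zero right_mult_zero_mat[of _ N N] mgint_zero)

text \<open>
  One step of the expansion of a matrix polynomial in the sequence \<open>P\<close>; it is possible because
  \<open>P n\<close> is monic.
\<close>

lemma remainder:
  assumes "G \<in> carrier_mat N N" "mdegree_le n G"
  obtains R where "R \<in> carrier_mat N N" "G = const_mpoly (mcoeff n G) * P n + R"
    "mdegree_le n R" "mcoeff n R = 0\<^sub>m N N"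
proof
  let ?L = "const_mpoly (mcoeff n G) * P n"
  have L: "?L \<in> carrier_mat N N" "mdegree_le n ?L"
    using assms by (auto intro!: mdegree_le_const_mult[of _ N N _ N] simp: P_degree)
  show "G - ?L \<in> carrier_mat N N" using assms L by simp
  show "G = ?L + (G - ?L)" by (rule eq_matI) (use assms L in auto)
  show "mdegree_le n (G - ?L)" using assms L by (intro mdegree_le_diff[of _ N N])
  have "mcoeff n ?L = mcoeff n G"
    using assms mcoeff_const_mult[of "mcoeff n G" N N "P n" N n] by (simp add: P_monic)
  then show "mcoeff n (G - ?L) = 0\<^sub>m N N"
    using assms L mcoeff_diff[of G N N ?L n] by simp
qed

lemma form_lower_degree:
  assumes "G \<in> carrier_mat N N" "mdegree_le m G" "m < n"
  shows "form (P n) G = 0\<^sub>m N N"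
  using assms
proof (induction m arbitrary: G)
  case (0 G)
  obtain R where R: "R \<in> carrier_mat N N" "G = const_mpoly (mcoeff 0 G) * P 0 + R"
    "mdegree_le 0 R" "mcoeff 0 R = 0\<^sub>m N N"
    using remainder 0 by blast
  have "R = 0\<^sub>m N N" using R mdegree_le_0_eq_zero by blast
  then have G: "G = const_mpoly (mcoeff 0 G) * P 0" using R(2) 0 by simp
  have "form (P n) (const_mpoly (mcoeff 0 G) * P 0) = form (P n) (P 0) * mat_adjoint (mcoeff 0 G)"
    using 0 by (intro form_const_right) auto
  also have "\<dots> = 0\<^sub>m N N" using P_orthogonal[of n 0] 0 by (simp add: form_def)
  finally show ?case using arg_cong[OF G, of "form (P n)"] by simp
next
  case (Suc m G)
  obtain R where R: "R \<in> carrier_mat N N" "G = const_mpoly (mcoeff (Suc m) G) * P (Suc m) + R"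
    "mdegree_le (Suc m) R" "mcoeff (Suc m) R = 0\<^sub>m N N"
    using remainder Suc.prems by blast
  have "form (P n) R = 0\<^sub>m N N"
    using Suc.IH[of R] Suc.prems R mdegree_le_lower by auto
  moreover have "form (P n) (const_mpoly (mcoeff (Suc m) G) * P (Suc m)) = 0\<^sub>m N N"
    using Suc.prems P_orthogonal[of n "Suc m"]
    by (subst form_const_right) (auto simp: form_def)
  moreover have "form (P n) (const_mpoly (mcoeff (Suc m) G) * P (Suc m) + R) =
      form (P n) (const_mpoly (mcoeff (Suc m) G) * P (Suc m)) + form (P n) R"
    using Suc.prems R by (intro form_add_right) auto
  ultimately show ?case using arg_cong[OF R(2), of "form (P n)"] by simp
qed

text \<open>
  Subtracting the multiple of \<open>P n\<close> with the same coefficient of \<open>x\<^sup>n\<close> leaves a remainder of lower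
  degree, to which \<open>P n\<close> is orthogonal.
\<close>

lemma form_same_degree:
  assumes "G \<in> carrier_mat N N" "mdegree_le n G"
  shows "form (P n) G = form (P n) (P n) * mat_adjoint (mcoeff n G)"
proof -
  obtain R where R: "R \<in> carrier_mat N N" "G = const_mpoly (mcoeff n G) * P n + R"
    "mdegree_le n R" "mcoeff n R = 0\<^sub>m N N"
    using remainder assms by blast
  have "form (P n) R = 0\<^sub>m N N"
  proof (cases n)
    case 0
    then have "R = 0\<^sub>m N N" using R mdegree_le_0_eq_zero by blast
    then show ?thesis by (simp add: form_zero_right)
  next
    case (Suc m)
    then show ?thesis using R mdegree_le_lower form_lower_degree[of R m n] by auto
  qed
  moreover have "form (P n) (const_mpoly (mcoeff n G) * P n + R) =
      form (P n) (const_mpoly (mcoeff n G) * P n) + form (P n) R"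
    using assms R by (intro form_add_right) auto
  moreover have "form (P n) (const_mpoly (mcoeff n G) * P n) = form (P n) (P n) * mat_adjoint (mcoeff n G)"
    using assms by (intro form_const_right) auto
  moreover have "form (P n) (P n) * mat_adjoint (mcoeff n G) \<in> carrier_mat N N"
    using assms by auto
  ultimately show ?thesis using arg_cong[OF R(2), of "form (P n)"] by simp
qed

text \<open>
  The key computation. After integration by parts the term with \<open>G'\<close> has degree too low to
  contribute, and \<open>G V\<close> has degree at most \<open>k + 2\<close>, so that \<open>P (k + 2)\<close> sees only its coefficient
  at that degree.
\<close>

lemma form_deriv_P:
  assumes "G \<in> carrier_mat N N" "mdegree_le k G"
  shows "form (mpoly_deriv (P (k + 2))) G =
    form (P (k + 2)) (P (k + 2)) * mat_adjoint (mcoeff 2 V) * mat_adjoint (mcoeff k G)"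
proof -
  have "mdegree_le (Suc k) G" by (rule mdegree_le_mono[OF assms(2)]) simp
  then have "form (P (k + 2)) (mpoly_deriv G) = 0\<^sub>m N N"
    using assms mdegree_le_deriv by (intro form_lower_degree[of _ k]) auto
  moreover have "form (P (k + 2)) (G * V) =
      form (P (k + 2)) (P (k + 2)) * mat_adjoint (mcoeff (k + 2) (G * V))"
    using assms by (intro form_same_degree mdegree_le_mult[OF _ V_carrier _ V_degree]) auto
  moreover have "mcoeff (k + 2) (G * V) = mcoeff k G * mcoeff 2 V"
    by (rule mcoeff_mult[OF assms(1) V_carrier assms(2) V_degree])
  moreover have "form (mpoly_deriv (P (k + 2))) G =
      form (P (k + 2)) (G * V) - form (P (k + 2)) (mpoly_deriv G)"
    using assms by (intro form_deriv) auto
  ultimately show ?thesis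
    using assms by (simp add: mat_diff_zero[of _ N N] mat_adjoint_mult[of _ N N _ N] assoc_mult_mat[of _ N N _ N _ N])
qed

text \<open>
  If \<open>C\<close> annihilates the squared norm of \<open>P n\<close> from the left, then \<open>C P n\<close> has norm zero, hence
  vanishes, and its coefficient of \<open>x\<^sup>n\<close> is \<open>C\<close>.
\<close>

lemma det_norm_nonzero: "det (form (P n) (P n)) \<noteq> 0"
proof (rule det_nonzero_if_left_kernel_trivial[where n = N])
  fix C assume C: "C \<in> carrier_mat N N" "C * form (P n) (P n) = 0\<^sub>m N N"
  let ?F = "const_mpoly C * P n"
  have "form ?F ?F = C * form (P n) ?F"
    using C by (intro form_const_left) auto
  also have "form (P n) ?F = form (P n) (P n) * mat_adjoint C"
    using C by (intro form_const_right) auto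
  also have "C * (form (P n) (P n) * mat_adjoint C) = C * form (P n) (P n) * mat_adjoint C"
    using C(1) by (intro assoc_mult_mat[symmetric]) auto
  also have "\<dots> = 0\<^sub>m N N" unfolding C(2) using C(1) by (intro left_mult_zero_mat) auto
  finally have "form ?F ?F = 0\<^sub>m N N" .
  then have "?F = 0\<^sub>m N N" using C by (intro definite) (auto simp: form_def)
  moreover have "mcoeff n ?F = C"
    using C mcoeff_const_mult[of C N N "P n" N n] by (simp add: P_monic)
  ultimately have "C = mcoeff n (0\<^sub>m N N)" by simp
  then show "C = 0\<^sub>m N N" by (auto simp: mcoeff_def intro!: eq_matI)
qed simp

text \<open>
  Let \<open>R\<close> be the difference of the two sides of the lowering relation. Its pairing with any \<open>G\<close> of
  degree at most \<open>k\<close> is the defect of the matrix identity on the right, times the adjoint of the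
  coefficient of \<open>x\<^sup>k\<close> in \<open>G\<close>. Testing with \<open>G = P k\<close> gives one direction. For the other one, \<open>R\<close> itself has
  degree at most \<open>k\<close>, because the monic normalisation makes the terms of degree \<open>k + 1\<close> cancel, so that
  \<open>R\<close> is orthogonal to itself.
\<close>

lemma lowering_iff:
  assumes M: "M \<in> carrier_mat N N"
  shows "mpoly_deriv (P (k + 2)) = const_mpoly (of_nat (k + 2) \<cdot>\<^sub>m 1\<^sub>m N) * P (k + 1) + const_mpoly M * P k \<longleftrightarrow>
    M * form (P k) (P k) = form (P (k + 2)) (P (k + 2)) * mat_adjoint (mcoeff 2 V)"
proof -
  let ?D = "mpoly_deriv (P (k + 2))"
  let ?c = "of_nat (k + 2) \<cdot>\<^sub>m 1\<^sub>m N :: complex mat"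
  let ?L = "const_mpoly ?c * P (k + 1)" and ?M = "const_mpoly M * P k"
  have c: "?c \<in> carrier_mat N N" by simp
  have carriers: "?D \<in> carrier_mat N N" "?L \<in> carrier_mat N N" "?M \<in> carrier_mat N N"
    using M by auto
  define R where "R = ?D - ?L - ?M"
  have [simp]: "R \<in> carrier_mat N N" unfolding R_def by (intro minus_carrier_mat carriers)
  have R_iff: "?D = ?L + ?M \<longleftrightarrow> R = 0\<^sub>m N N"
    unfolding R_def by (simp only: mat_diff_diff_eq[of _ N N] mat_diff_eq_zero_iff[of _ N N] add_carrier_mat carriers)
  have form_R: "form R G = (form (P (k + 2)) (P (k + 2)) * mat_adjoint (mcoeff 2 V)
      - M * form (P k) (P k)) * mat_adjoint (mcoeff k G)"
    if G: "G \<in> carrier_mat N N" "mdegree_le k G" for G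
  proof -
    have "form R G = form ?D G - form ?L G - form ?M G"
      unfolding R_def using G by (simp only: form_diff_left carriers minus_carrier_mat)
    also have "form ?L G = ?c * form (P (k + 1)) G"
      using c G by (intro form_const_left) auto
    also have "form (P (k + 1)) G = 0\<^sub>m N N"
      using G by (intro form_lower_degree) auto
    also have "form ?M G = M * form (P k) G"
      using M G by (intro form_const_left) auto
    also have "form (P k) G = form (P k) (P k) * mat_adjoint (mcoeff k G)"
      using G by (rule form_same_degree)
    also note form_deriv_P[OF G]
    finally have "form R G = form (P (k + 2)) (P (k + 2)) * mat_adjoint (mcoeff 2 V) * mat_adjoint (mcoeff k G)
        - ?c * 0\<^sub>m N N - M * (form (P k) (P k) * mat_adjoint (mcoeff k G))" .
    also have "\<dots> = form (P (k + 2)) (P (k + 2)) * mat_adjoint (mcoeff 2 V) * mat_adjoint (mcoeff k G)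
        - M * form (P k) (P k) * mat_adjoint (mcoeff k G)"
      using M G c by (auto simp: assoc_mult_mat[of _ N N _ N _ N] intro!: eq_matI)
    finally show ?thesis
      using M G by (simp add: minus_mult_distrib_mat[of _ N N _ _ N])
  qed
  show ?thesis unfolding R_iff
  proof
    assume "R = 0\<^sub>m N N"
    then have "form R (P k) = 0\<^sub>m N N"
      by (simp add: form_zero_left)
    moreover have "form R (P k) = form (P (k + 2)) (P (k + 2)) * mat_adjoint (mcoeff 2 V) - M * form (P k) (P k)"
      unfolding form_R[OF P_carrier P_degree] P_monic mat_adjoint_one
      using M by (intro right_mult_one_mat[of _ N N]) auto
    ultimately have "form (P (k + 2)) (P (k + 2)) * mat_adjoint (mcoeff 2 V) - M * form (P k) (P k) = 0\<^sub>m N N"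
      by simp
    then show "M * form (P k) (P k) = form (P (k + 2)) (P (k + 2)) * mat_adjoint (mcoeff 2 V)"
      using M by (subst (asm) mat_diff_eq_zero_iff) auto
  next
    assume eq: "M * form (P k) (P k) = form (P (k + 2)) (P (k + 2)) * mat_adjoint (mcoeff 2 V)"
    \<comment> \<open>The three terms have degree at most \<open>k + 1\<close>; at this degree only \<open>?D\<close> and \<open>?L\<close> contribute.\<close>
    have "mdegree_le (Suc k) R"
      unfolding R_def
      using M c mdegree_le_deriv[of "Suc k" "P (k + 2)"] P_degree[of "k + 2"] P_degree[of "k + 1"]
        mdegree_le_mono[OF P_degree[of k], of "Suc k"]
      by (auto intro!: mdegree_le_diff[of _ N N] mdegree_le_const_mult[of _ N N _ N])
    moreover have "mcoeff (Suc k) R = 0\<^sub>m N N"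
    proof -
      have "mcoeff (Suc k) ?D = ?c"
        using P_monic[of "k + 2"] by (simp add: mcoeff_deriv)
      moreover have "mcoeff (Suc k) ?L = ?c"
        using mcoeff_const_mult[OF c P_carrier, of "Suc k" "k + 1"] P_monic[of "k + 1"] c by simp
      moreover have "mcoeff (Suc k) ?M = 0\<^sub>m N N"
        using M P_degree[of k] by (intro mcoeff_above_degree mdegree_le_const_mult[of _ N N _ N]) auto
      moreover have "mcoeff (Suc k) R = mcoeff (Suc k) ?D - mcoeff (Suc k) ?L - mcoeff (Suc k) ?M"
        by (simp only: R_def mcoeff_diff[of _ N N] carriers minus_carrier_mat)
      ultimately have "mcoeff (Suc k) R = ?c - ?c - 0\<^sub>m N N"
        by (simp only:)
      also have "\<dots> = 0\<^sub>m N N" by (rule eq_matI) auto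
      finally show ?thesis .
    qed
    ultimately have R_degree: "mdegree_le k R" by (rule mdegree_le_lower[OF \<open>R \<in> carrier_mat N N\<close>])
    have "form R R = (form (P (k + 2)) (P (k + 2)) * mat_adjoint (mcoeff 2 V)
        - form (P (k + 2)) (P (k + 2)) * mat_adjoint (mcoeff 2 V)) * mat_adjoint (mcoeff k R)"
      using form_R[OF \<open>R \<in> carrier_mat N N\<close> R_degree] unfolding eq .
    also have "\<dots> = 0\<^sub>m N N * mat_adjoint (mcoeff k R)"
      by (subst minus_r_inv_mat[of _ N N]) auto
    also have "\<dots> = 0\<^sub>m N N" by (intro left_mult_zero_mat) auto
    finally have "form R R = 0\<^sub>m N N" .
    then show "R = 0\<^sub>m N N" by (intro definite) (auto simp: form_def)
  qed
qed

corollary lowering_iff_inverse: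
  assumes M: "M \<in> carrier_mat N N"
  shows "mpoly_deriv (P (k + 2)) = const_mpoly (of_nat (k + 2) \<cdot>\<^sub>m 1\<^sub>m N) * P (k + 1) + const_mpoly M * P k \<longleftrightarrow>
    M = form (P (k + 2)) (P (k + 2)) * mat_adjoint (mcoeff 2 V) * mat_inv (form (P k) (P k))"
proof -
  let ?H = "form (P k) (P k)" and ?B = "form (P (k + 2)) (P (k + 2)) * mat_adjoint (mcoeff 2 V)"
  have H: "?H \<in> carrier_mat N N" and B: "?B \<in> carrier_mat N N" by simp_all
  note inverse = mat_inv_inverse[OF H det_norm_nonzero]
  have "M * ?H = ?B \<longleftrightarrow> M = ?B * mat_inv ?H"
  proof
    assume eq: "M * ?H = ?B"
    have "?B * mat_inv ?H = M * (?H * mat_inv ?H)"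
      unfolding eq[symmetric] by (rule assoc_mult_mat[OF M H inverse(1)])
    then show "M = ?B * mat_inv ?H" using M by (simp only: inverse right_mult_one_mat)
  next
    assume eq: "M = ?B * mat_inv ?H"
    have "M * ?H = ?B * (mat_inv ?H * ?H)"
      unfolding eq by (rule assoc_mult_mat[OF B inverse(1) H])
    then show "M * ?H = ?B" using B by (simp only: inverse right_mult_one_mat)
  qed
  then show ?thesis using lowering_iff[OF M] by simp
qed

end

section \<open>Normalised Hermite polynomials\<close>

text \<open>
  These are \<open>H\<^sub>n / n!\<close>, the coefficients of the generating function \<open>exp (2 x t - t\<^sup>2)\<close>.
\<close>

fun hermite_normalized :: "nat \<Rightarrow> complex poly" where
  "hermite_normalized 0 = 1"
| "hermite_normalized (Suc 0) = [:0, 2:]"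
| "hermite_normalized (Suc (Suc n)) = Polynomial.smult (1 / of_nat (Suc (Suc n)))
     ([:0, 2:] * hermite_normalized (Suc n) - Polynomial.smult 2 (hermite_normalized n))"

lemma poly_hermite_normalized:
  "poly (hermite_normalized n) (complex_of_real x) = complex_of_real (poly (hermite n) x / fact n)"
proof (induction n rule: hermite_normalized.induct)
  case (3 n)
  have quotient: "(2 * x * (a / (u * f)) - 2 * (b / f)) / v = (2 * x * a - 2 * u * b) / (v * (u * f))"
    if "f \<noteq> 0" "u \<noteq> 0" "v \<noteq> 0" for a b f u v :: real
    using that by (simp add: field_simps)
  have "poly (hermite_normalized (Suc (Suc n))) (complex_of_real x) =
      complex_of_real ((2 * x * (poly (hermite (Suc n)) x / fact (Suc n)) - 2 * (poly (hermite n) x / fact n))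
        / real (Suc (Suc n)))"
    by (simp only: hermite_normalized.simps poly_smult poly_diff poly_mult 3) (simp add: mult_ac)
  also have "(2 * x * (poly (hermite (Suc n)) x / fact (Suc n)) - 2 * (poly (hermite n) x / fact n))
        / real (Suc (Suc n)) = poly (hermite (Suc (Suc n))) x / fact (Suc (Suc n))"
    using quotient[of "fact n" "real (Suc n)" "real (Suc (Suc n))" "poly (hermite (Suc n)) x" "poly (hermite n) x"]
    by (simp add: mult_ac del: of_nat_Suc)
  finally show ?case .
qed simp_all

text \<open>
  Extension by zero to negative indices: the recurrences then hold for all integers, and the
  products of \<open>L\<close> with banded matrices need no boundary cases.
\<close>

definition hermite_int :: "int \<Rightarrow> complex poly" where
  "hermite_int m = (if m < 0 then 0 else hermite_normalized (nat m))"

lemma hermite_int_recurrence: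
  "Polynomial.smult (of_int (m + 1)) (hermite_int (m + 1)) =
     [:0, 2:] * hermite_int m - Polynomial.smult 2 (hermite_int (m - 1))"
proof -
  have "m < -1 \<or> m = -1 \<or> m = 0 \<or> m = int (Suc (nat (m - 1)))" by auto
  then consider "m < -1" | "m = -1" | "m = 0" | n where "m = int (Suc n)" by blast
  then show ?thesis
  proof cases
    case (4 n)
    have "hermite_int (m + 1) = hermite_normalized (Suc (Suc n))" "hermite_int m = hermite_normalized (Suc n)"
      "hermite_int (m - 1) = hermite_normalized n"
      by (simp_all add: hermite_int_def 4 nat_add_distrib)
    moreover have "(of_int (m + 1) :: complex) = of_nat (Suc (Suc n))" by (simp add: 4)
    moreover have "(of_nat (Suc (Suc n)) :: complex) \<noteq> 0" by (rule of_nat_neq_0)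
    ultimately show ?thesis by (simp only: hermite_normalized.simps smult_smult) (simp del: of_nat_Suc)
  qed (simp_all add: hermite_int_def)
qed

text \<open>
  Write \<open>h(n)\<close> for the normalised polynomials. Differentiating the recurrence produces
  \<open>2 x h(n - 1) - h'(n - 1)\<close>, which the induction hypothesis and the recurrence identify as \<open>n h(n)\<close>.
\<close>

lemma pderiv_hermite_normalized:
  "pderiv (hermite_normalized (Suc n)) = Polynomial.smult 2 (hermite_normalized n)"
proof (induction n rule: less_induct)
  case (less n)
  show ?case
  proof (cases n)
    case 0
    then show ?thesis by (simp add: pderiv_pCons)
  next
    case (Suc l)
    have IH1: "pderiv (hermite_normalized n) = Polynomial.smult 2 (hermite_normalized l)"
      using less Suc by auto
    have IH2: "[:0, 2:] * hermite_normalized l - pderiv (hermite_normalized l) = Polynomial.smult (of_nat n) (hermite_normalized n)"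
    proof (cases l)
      case 0
      then show ?thesis by (simp add: Suc)
    next
      case (Suc l')
      have "pderiv (hermite_normalized l) = Polynomial.smult 2 (hermite_normalized l')"
        using less[of l'] Suc \<open>n = Suc l\<close> by auto
      moreover have "(of_nat n :: complex) \<noteq> 0"
        unfolding \<open>n = Suc l\<close> by (rule of_nat_neq_0)
      ultimately show ?thesis using \<open>n = Suc l\<close> Suc by (simp del: mult_pCons_left of_nat_Suc)
    qed
    have collect: "Polynomial.smult c (Polynomial.smult 2 h + Polynomial.smult 2 (Polynomial.smult a h)) =
        Polynomial.smult (c * (2 * (1 + a))) h" for c a :: complex and h
      by (rule poly_eqI) (simp add: algebra_simps)
    have "pderiv (hermite_normalized (Suc n)) = Polynomial.smult (1 / of_nat (Suc n))
        (Polynomial.smult 2 (hermite_normalized n) + [:0, 2:] * pderiv (hermite_normalized n)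
          - Polynomial.smult 2 (pderiv (hermite_normalized l)))"
      by (simp add: Suc pderiv_smult pderiv_diff pderiv_mult pderiv_pCons del: mult_pCons_left of_nat_Suc)
        (simp add: algebra_simps)
    also have "\<dots> = Polynomial.smult (1 / of_nat (Suc n))
        (Polynomial.smult 2 (hermite_normalized n) +
          Polynomial.smult 2 ([:0, 2:] * hermite_normalized l - pderiv (hermite_normalized l)))"
      unfolding IH1 by (simp add: smult_diff_right smult_add_right del: mult_pCons_left of_nat_Suc)
    also have "\<dots> = Polynomial.smult (1 / of_nat (Suc n) * (2 * of_nat (Suc n))) (hermite_normalized n)"
      unfolding IH2 of_nat_Suc by (rule collect)
    also have "1 / of_nat (Suc n) * (2 * of_nat (Suc n)) = (2 :: complex)"
      by (simp del: of_nat_Suc)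
    finally show ?thesis .
  qed
qed

lemma pderiv_hermite_int: "pderiv (hermite_int m) = Polynomial.smult 2 (hermite_int (m - 1))"
proof (cases "m \<le> 0")
  case True
  then show ?thesis by (cases "m = 0") (auto simp: hermite_int_def)
next
  case False
  then obtain n where "m = int (Suc n)"
    by (metis gr0_implies_Suc not_le zero_less_imp_eq_int)
  then show ?thesis
    using pderiv_hermite_normalized[of n] by (simp add: hermite_int_def nat_add_distrib)
qed

lemma sum_band_above:
  fixes f :: "nat \<Rightarrow> 'a :: semiring_0"
  shows "(\<Sum>j<N. (if j = i + r then c else 0) * f j) = (if i + r < N then c * f (i + r) else 0)"
proof -
  have "(\<Sum>j<N. (if j = i + r then c else 0) * f j) = (\<Sum>j<N. if j = i + r then c * f j else 0)"
    by (intro sum.cong) auto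
  then show ?thesis by (simp add: sum.delta)
qed

lemma sum_band_below:
  fixes f :: "nat \<Rightarrow> 'a :: semiring_0"
  assumes "i < N"
  shows "(\<Sum>j<N. (if i = j + r then c else 0) * f j) = (if r \<le> i then c * f (i - r) else 0)"
proof -
  have "(\<Sum>j<N. (if i = j + r then c else 0) * f j) = (\<Sum>j<N. if j = i - r then (if r \<le> i then c * f j else 0) else 0)"
    by (intro sum.cong) auto
  moreover have "i - r < N" using assms by simp
  ultimately show ?thesis by (simp add: sum.delta)
qed

section \<open>The Hermite matrix weight\<close>

locale hermite_weight =
  fixes N :: nat and \<alpha> :: "nat \<Rightarrow> real"
  assumes \<alpha>_pos: "\<And>j. j \<in> {1..N} \<Longrightarrow> 0 < \<alpha> j"
    and \<alpha>_ratio: "\<And>j. j \<in> {2..N} \<Longrightarrow> 2 * \<alpha> j / \<alpha> (j - 1) = sqrt ((real j - 1) * (real N - real j + 1))"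
begin

text \<open>
  Conjugation of \<open>f\<close> by the diagonal matrix of the \<open>\<alpha> j\<close>. All matrices built from \<open>L\<close>, \<open>A\<close> and \<open>A\<^sup>*\<close> are
  of this form, with \<open>f\<close> free of \<open>\<alpha>\<close> once the condition on the ratios has been used.
\<close>

definition conj_\<alpha> :: "(nat \<Rightarrow> nat \<Rightarrow> complex poly) \<Rightarrow> complex poly mat" where
  "conj_\<alpha> f = mat N N (\<lambda>(i, k). Polynomial.smult (complex_of_real (\<alpha> (Suc i) / \<alpha> (Suc k))) (f i k))"

lemma conj_\<alpha>_carrier [simp]: "conj_\<alpha> f \<in> carrier_mat N N"
  by (simp add: conj_\<alpha>_def)

lemma conj_\<alpha>_cong: "(\<And>i k. i < N \<Longrightarrow> k < N \<Longrightarrow> f i k = g i k) \<Longrightarrow> conj_\<alpha> f = conj_\<alpha> g"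
  unfolding conj_\<alpha>_def by (rule cong_mat) auto

lemma \<alpha>_nonzero: "i < N \<Longrightarrow> \<alpha> (Suc i) \<noteq> 0"
  using \<alpha>_pos[of "Suc i"] by simp

lemma conj_\<alpha>_mult: "conj_\<alpha> f * conj_\<alpha> g = conj_\<alpha> (\<lambda>i k. \<Sum>j<N. f i j * g j k)"
proof (rule eq_matI)
  fix i k assume "i < dim_row (conj_\<alpha> (\<lambda>i k. \<Sum>j<N. f i j * g j k))"
    "k < dim_col (conj_\<alpha> (\<lambda>i k. \<Sum>j<N. f i j * g j k))"
  then have ik: "i < N" "k < N" by (simp_all add: conj_\<alpha>_def)
  have ratio: "\<alpha> (Suc i) / \<alpha> (Suc j) * (\<alpha> (Suc j) / \<alpha> (Suc k)) = \<alpha> (Suc i) / \<alpha> (Suc k)" if "j < N" for j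
    using \<alpha>_nonzero[OF that] by simp
  have "(conj_\<alpha> f * conj_\<alpha> g) $$ (i, k) =
      (\<Sum>j<N. Polynomial.smult
        (complex_of_real (\<alpha> (Suc i) / \<alpha> (Suc j)) * complex_of_real (\<alpha> (Suc j) / \<alpha> (Suc k))) (f i j * g j k))"
    using ik by (subst mult_mat_index[of _ N N _ N])
      (simp_all add: conj_\<alpha>_def mult_ac del: of_real_divide)
  also have "\<dots> = (\<Sum>j<N. Polynomial.smult (complex_of_real (\<alpha> (Suc i) / \<alpha> (Suc k))) (f i j * g j k))"
    by (intro sum.cong refl) (simp only: of_real_mult[symmetric] ratio lessThan_iff)
  also have "\<dots> = conj_\<alpha> (\<lambda>i k. \<Sum>j<N. f i j * g j k) $$ (i, k)"
    using ik by (simp add: conj_\<alpha>_def smult_sum2)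
  finally show "(conj_\<alpha> f * conj_\<alpha> g) $$ (i, k) = conj_\<alpha> (\<lambda>i k. \<Sum>j<N. f i j * g j k) $$ (i, k)" .
qed (simp_all add: conj_\<alpha>_def)

definition L_poly :: "complex poly mat" where
  "L_poly = conj_\<alpha> (\<lambda>i k. hermite_int (int i - int k))"

definition A_poly :: "complex poly mat" where
  "A_poly = const_mpoly (A_mat N \<alpha>)"

text \<open>
  This is the conjugate \<open>L A\<^sup>* L\<^sup>-\<^sup>1\<close>, written out. In terms of \<open>H = [A, A\<^sup>*]\<close> and \<open>D = x - A / 2\<close> it equals
  \<open>A\<^sup>* + H D + A / 2 - D\<^sup>2 A\<close>; the five bands below are those of \<open>A\<^sup>*\<close>, \<open>x H\<close>, then the multiples of
  \<open>A\<close>, \<open>A\<^sup>2\<close> and \<open>A\<^sup>3\<close>. The summand \<open>i + 0\<close> gives the diagonal band the shape that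
  \<open>sum_band_above\<close> expects.
\<close>

definition E_poly :: "complex poly mat" where
  "E_poly = conj_\<alpha> (\<lambda>i k.
     (if k = i + 1 then [:of_nat (i + 1) * (of_nat N - of_nat (i + 1)) / 2:] else 0) +
     (if k = i + 0 then [:0, 2 * of_nat i + 1 - of_nat N:] else 0) +
     (if i = k + 1 then [:of_nat N - 2 * of_nat i, 0, - 2:] else 0) +
     (if i = k + 2 then [:0, 4:] else 0) +
     (if i = k + 3 then [:- 2:] else 0))"

lemma L_poly_carrier [simp]: "L_poly \<in> carrier_mat N N"
  by (simp add: L_poly_def)

lemma A_mat_carrier [simp]: "A_mat N \<alpha> \<in> carrier_mat N N"
  by (simp add: A_mat_def)

lemma A_poly_carrier [simp]: "A_poly \<in> carrier_mat N N"
  by (simp add: A_poly_def)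

lemma E_poly_carrier [simp]: "E_poly \<in> carrier_mat N N"
  by (simp add: E_poly_def)

lemma A_poly_eq_conj: "A_poly = conj_\<alpha> (\<lambda>i k. if i = k + 1 then [:2:] else 0)"
  unfolding A_poly_def const_mpoly_def A_mat_def conj_\<alpha>_def
  by (rule eq_matI) auto

text \<open>
  The condition on the ratios of the \<open>\<alpha> j\<close> turns \<open>(2 \<alpha> (j + 1) / \<alpha> j)\<^sup>2\<close> into \<open>j (N - j)\<close>, which makes the
  superdiagonal of \<open>A\<^sup>*\<close> free of \<open>\<alpha>\<close> up to conjugation.
\<close>

lemma A_poly_adjoint_eq_conj:
  "mpoly_adjoint A_poly =
    conj_\<alpha> (\<lambda>i k. if k = i + 1 then [:of_nat (i + 1) * (of_nat N - of_nat (i + 1)) / 2:] else 0)"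
proof -
  have ratio: "\<alpha> (Suc i) / \<alpha> (Suc (Suc i)) * (real (i + 1) * (real N - real (i + 1)) / 2) =
      2 * \<alpha> (Suc (Suc i)) / \<alpha> (Suc i)" if i: "Suc i < N" for i
  proof -
    have pos: "0 < \<alpha> (Suc i)" "0 < \<alpha> (Suc (Suc i))" using \<alpha>_pos i by auto
    have "(2 * \<alpha> (Suc (Suc i)) / \<alpha> (Suc i))\<^sup>2 = (sqrt (real (i + 1) * (real N - real (i + 1))))\<^sup>2"
      using \<alpha>_ratio[of "Suc (Suc i)"] i by (simp add: algebra_simps)
    also have "\<dots> = real (i + 1) * (real N - real (i + 1))"
      using i by (intro real_sqrt_pow2 mult_nonneg_nonneg) auto
    finally show ?thesis
      using pos by (simp add: field_simps power2_eq_square)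
  qed
  show ?thesis
  proof (rule eq_matI)
    fix i k assume "i < dim_row (conj_\<alpha> (\<lambda>i k. if k = i + 1 then [:of_nat (i + 1) * (of_nat N - of_nat (i + 1)) / 2:] else 0))"
      "k < dim_col (conj_\<alpha> (\<lambda>i k. if k = i + 1 then [:of_nat (i + 1) * (of_nat N - of_nat (i + 1)) / 2:] else 0))"
    then have ik: "i < N" "k < N" by (simp_all add: conj_\<alpha>_def)
    show "mpoly_adjoint A_poly $$ (i, k) =
      conj_\<alpha> (\<lambda>i k. if k = i + 1 then [:of_nat (i + 1) * (of_nat N - of_nat (i + 1)) / 2:] else 0) $$ (i, k)"
      using ik arg_cong[OF ratio[of i], of complex_of_real]
      by (auto simp: mpoly_adjoint_def A_poly_def const_mpoly_def A_mat_def conj_\<alpha>_def)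
  qed (simp_all add: mpoly_adjoint_def A_poly_def const_mpoly_def A_mat_def conj_\<alpha>_def)
qed

lemma hermite_int_neg: "m < 0 \<Longrightarrow> hermite_int m = 0"
  by (simp add: hermite_int_def)

text \<open>
  These are the rules for \<open>L = exp (x A - A\<^sup>2 / 4)\<close>. In entries, \<open>L'\<close>, \<open>A L\<close> and \<open>L A\<close> are all equal to
  \<open>2 h(i - k - 1)\<close>, conjugated by the \<open>\<alpha> j\<close>.
\<close>

lemma L_poly_deriv: "mpoly_deriv L_poly = A_poly * L_poly" "A_poly * L_poly = L_poly * A_poly"
proof -
  have left: "(\<Sum>j<N. (if i = j + 1 then [:2:] else 0) * hermite_int (int j - int k)) =
      Polynomial.smult 2 (hermite_int (int i - int k - 1))" if "i < N" for i k
    unfolding sum_band_below[OF that] by (auto simp: of_nat_diff hermite_int_neg algebra_simps)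
  have right: "(\<Sum>j<N. hermite_int (int i - int j) * (if j = k + 1 then [:2:] else 0)) =
      Polynomial.smult 2 (hermite_int (int i - int k - 1))" if "i < N" for i k
  proof -
    have "(\<Sum>j<N. hermite_int (int i - int j) * (if j = k + 1 then [:2:] else 0)) =
        (\<Sum>j<N. (if j = k + 1 then [:2:] else 0) * hermite_int (int i - int j))"
      by (intro sum.cong) (auto simp: mult.commute)
    then show ?thesis
      unfolding sum_band_above using that by (auto simp: hermite_int_neg algebra_simps)
  qed
  have AL: "A_poly * L_poly = conj_\<alpha> (\<lambda>i k. Polynomial.smult 2 (hermite_int (int i - int k - 1)))"
    unfolding A_poly_eq_conj L_poly_def conj_\<alpha>_mult using left by (intro conj_\<alpha>_cong)
  have LA: "L_poly * A_poly = conj_\<alpha> (\<lambda>i k. Polynomial.smult 2 (hermite_int (int i - int k - 1)))"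
    unfolding A_poly_eq_conj L_poly_def conj_\<alpha>_mult using right by (intro conj_\<alpha>_cong)
  show "A_poly * L_poly = L_poly * A_poly" by (simp only: AL LA)
  show "mpoly_deriv L_poly = A_poly * L_poly"
    unfolding AL unfolding L_poly_def
    by (rule eq_matI) (auto simp: conj_\<alpha>_def mpoly_deriv_def pderiv_smult pderiv_hermite_int)
qed

text \<open>
  The entry \<open>(i, k)\<close> of \<open>L A\<^sup>* = E L\<close>, for \<open>m = i - k\<close>. It follows from the recurrence for the
  indices \<open>m\<close>, \<open>m - 1\<close> and \<open>m - 2\<close>, since
  \<open>k (n - k) - (i + 1) (n - i - 1) = (m + 1) (2 i + 1 - n - m)\<close>.
\<close>

lemma hermite_conjugation_identity:
  fixes m :: int and i k n :: complex
  assumes "k = i - of_int m"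
  shows "Polynomial.smult (k * (n - k) / 2) (hermite_int (m + 1)) =
    [:(i + 1) * (n - (i + 1)) / 2:] * hermite_int (m + 1) + [:0, 2 * i + 1 - n:] * hermite_int m +
    [:n - 2 * i, 0, - 2:] * hermite_int (m - 1) + [:0, 4:] * hermite_int (m - 2) + [:- 2:] * hermite_int (m - 3)"
proof (rule poly_eq_poly_eq_iff[THEN iffD1, OF ext])
  fix z :: complex
  define M :: complex where "M = of_int m"
  let ?h = "\<lambda>r. poly (hermite_int (m - r)) z"
  have recurrence: "(M - of_int r + 1) * poly (hermite_int (m - r + 1)) z = 2 * z * ?h r - 2 * ?h (r + 1)" for r
    using arg_cong[OF hermite_int_recurrence[of "m - r"], of "\<lambda>p. poly p z"]
    by (simp add: M_def diff_diff_eq mult_ac)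
  have r0: "(M + 1) * poly (hermite_int (m + 1)) z = 2 * z * ?h 0 - 2 * ?h 1"
    using recurrence[of 0] by simp
  have r1: "M * ?h 0 = 2 * z * ?h 1 - 2 * ?h 2"
    using recurrence[of 1] by simp
  have r2: "(M - 1) * ?h 1 = 2 * z * ?h 2 - 2 * ?h 3"
    using recurrence[of 2] by (simp add: algebra_simps)
  \<comment> \<open>The multipliers of the three recurrences are \<open>(2 i + 1 - n - m) / 2\<close>, \<open>- z\<close> and \<open>1\<close>.\<close>
  have combination: "(i - M) * (n - (i - M)) / 2 * h1 -
      ((i + 1) * (n - (i + 1)) / 2 * h1 + z * (2 * i + 1 - n) * h0 + (n - 2 * i - 2 * z * z) * g1 + 4 * z * g2 - 2 * g3) =
      (2 * i + 1 - n - M) / 2 * ((M + 1) * h1 - (2 * z * h0 - 2 * g1))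
      - z * (M * h0 - (2 * z * g1 - 2 * g2)) + ((M - 1) * g1 - (2 * z * g2 - 2 * g3))" for h1 h0 g1 g2 g3
    by (simp add: field_simps)
  have "(i - M) * (n - (i - M)) / 2 * poly (hermite_int (m + 1)) z -
      ((i + 1) * (n - (i + 1)) / 2 * poly (hermite_int (m + 1)) z + z * (2 * i + 1 - n) * ?h 0
        + (n - 2 * i - 2 * z * z) * ?h 1 + 4 * z * ?h 2 - 2 * ?h 3) = 0"
    unfolding combination r0 r1 r2 by simp
  then show "poly (Polynomial.smult (k * (n - k) / 2) (hermite_int (m + 1))) z =
    poly ([:(i + 1) * (n - (i + 1)) / 2:] * hermite_int (m + 1) + [:0, 2 * i + 1 - n:] * hermite_int m +
      [:n - 2 * i, 0, - 2:] * hermite_int (m - 1) + [:0, 4:] * hermite_int (m - 2) + [:- 2:] * hermite_int (m - 3)) z"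
    unfolding assms M_def[symmetric] by (simp add: algebra_simps)
qed

lemma L_poly_A_adjoint: "L_poly * mpoly_adjoint A_poly = E_poly * L_poly"
proof -
  have left: "(\<Sum>j<N. hermite_int (int i - int j) *
        (if k = j + 1 then [:of_nat (j + 1) * (of_nat N - of_nat (j + 1)) / 2:] else 0)) =
      Polynomial.smult (of_nat k * (of_nat N - of_nat k) / 2) (hermite_int (int i - int k + 1))"
    if "k < N" for i k
  proof -
    have "(\<Sum>j<N. hermite_int (int i - int j) *
        (if k = j + 1 then [:of_nat (j + 1) * (of_nat N - of_nat (j + 1)) / 2:] else 0)) =
      (\<Sum>j<N. (if k = j + 1 then [:of_nat k * (of_nat N - of_nat k) / 2:] else 0) * hermite_int (int i - int j))"
      by (intro sum.cong) (auto simp: mult.commute)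
    also have "\<dots> = Polynomial.smult (of_nat k * (of_nat N - of_nat k) / 2) (hermite_int (int i - int k + 1))"
      unfolding sum_band_below[OF that] by (auto simp: of_nat_diff algebra_simps)
    finally show ?thesis .
  qed
  have right: "(\<Sum>j<N.
     ((if j = i + 1 then [:of_nat (i + 1) * (of_nat N - of_nat (i + 1)) / 2:] else 0) +
     (if j = i + 0 then [:0, 2 * of_nat i + 1 - of_nat N:] else 0) +
     (if i = j + 1 then [:of_nat N - 2 * of_nat i, 0, - 2:] else 0) +
     (if i = j + 2 then [:0, 4:] else 0) +
     (if i = j + 3 then [:- 2:] else 0)) * hermite_int (int j - int k)) =
     [:of_nat (i + 1) * (of_nat N - of_nat (i + 1)) / 2:] * hermite_int (int i - int k + 1)
     + [:0, 2 * of_nat i + 1 - of_nat N:] * hermite_int (int i - int k)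
     + [:of_nat N - 2 * of_nat i, 0, - 2:] * hermite_int (int i - int k - 1)
     + [:0, 4:] * hermite_int (int i - int k - 2)
     + [:- 2:] * hermite_int (int i - int k - 3)"
    if "i < N" for i k
  proof -
    \<comment> \<open>In the last row the term beyond the boundary has the coefficient \<open>N - (i + 1) = 0\<close>.\<close>
    have above: "(if i + 1 < N then [:of_nat (i + 1) * (of_nat N - of_nat (i + 1)) / 2:] * hermite_int (int (i + 1) - int k) else 0) =
        [:of_nat (i + 1) * (of_nat N - of_nat (i + 1)) / 2:] * hermite_int (int i - int k + 1)"
    proof (cases "i + 1 < N")
      case False
      then have "N = i + 1" using that by simp
      then show ?thesis by simp
    qed (simp add: algebra_simps)
    \<comment> \<open>For \<open>i < r\<close> the index \<open>i - k - r\<close> is negative, so the missing terms are zero anyway.\<close>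
    have below: "(if r \<le> i then c * hermite_int (int (i - r) - int k) else 0) = c * hermite_int (int i - int k - int r)"
      for r c by (auto simp: of_nat_diff hermite_int_neg algebra_simps)
    show ?thesis
      unfolding distrib_right sum.distrib sum_band_above sum_band_below[OF that] below above
      using that by simp
  qed
  show ?thesis
    unfolding A_poly_adjoint_eq_conj L_poly_def E_poly_def conj_\<alpha>_mult
  proof (rule conj_\<alpha>_cong)
    fix i k assume ik: "i < N" "k < N"
    have "(of_nat k :: complex) = of_nat i - of_int (int i - int k)" by simp
    from hermite_conjugation_identity[OF this, of "of_nat N"]
    show "(\<Sum>j<N. hermite_int (int i - int j) *
        (if k = j + 1 then [:of_nat (j + 1) * (of_nat N - of_nat (j + 1)) / 2:] else 0)) =
      (\<Sum>j<N.
     ((if j = i + 1 then [:of_nat (i + 1) * (of_nat N - of_nat (i + 1)) / 2:] else 0) +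
     (if j = i + 0 then [:0, 2 * of_nat i + 1 - of_nat N:] else 0) +
     (if i = j + 1 then [:of_nat N - 2 * of_nat i, 0, - 2:] else 0) +
     (if i = j + 2 then [:0, 4:] else 0) +
     (if i = j + 3 then [:- 2:] else 0)) * hermite_int (int j - int k))"
      unfolding left[OF ik(2)] right[OF ik(1)] by (simp only: of_nat_add of_nat_1)
  qed
qed

definition S_poly :: "complex poly mat" where
  "S_poly = L_poly * mpoly_adjoint L_poly"

text \<open>
  The solution \<open>V\<close> of \<open>S (E\<^sup>* + A\<^sup>*) = 2 x S - S V\<^sup>*\<close>.
\<close>

definition V_poly :: "complex poly mat" where
  "V_poly = [:0, 2:] \<cdot>\<^sub>m 1\<^sub>m N - E_poly - A_poly"

lemma S_poly_carrier [simp]: "S_poly \<in> carrier_mat N N"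
  by (simp add: S_poly_def)

lemma V_poly_carrier [simp]: "V_poly \<in> carrier_mat N N"
  by (simp add: V_poly_def)

text \<open>
  In \<open>S' = L' L\<^sup>* + L L'\<^sup>*\<close>, the first term is \<open>A L L\<^sup>* = L A L\<^sup>* = L L\<^sup>* E\<^sup>*\<close> and the second one is \<open>L L\<^sup>* A\<^sup>*\<close>.
\<close>

lemma S_poly_pearson: "mpoly_deriv S_poly = [:0, 2:] \<cdot>\<^sub>m S_poly - S_poly * mpoly_adjoint V_poly"
proof -
  let ?L = "mpoly_adjoint L_poly" and ?A = "mpoly_adjoint A_poly" and ?E = "mpoly_adjoint E_poly"
  note assoc = assoc_mult_mat[of _ N N _ N _ N]
  have adjoint_A: "mpoly_adjoint (mpoly_adjoint A_poly) = A_poly"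
    by (rule eq_matI) (auto simp: mpoly_adjoint_def map_poly_map_poly o_def)
  have "mpoly_adjoint (L_poly * ?A) = mpoly_adjoint (E_poly * L_poly)"
    by (simp only: L_poly_A_adjoint)
  then have AL: "A_poly * ?L = ?L * ?E"
    by (simp add: mpoly_adjoint_mult[of _ N N _ N] adjoint_A)
  have "mpoly_deriv S_poly = mpoly_deriv L_poly * ?L + L_poly * mpoly_deriv ?L"
    unfolding S_poly_def by (rule mpoly_deriv_mult[of _ N N _ N]) simp_all
  also have "mpoly_deriv ?L = ?L * ?A"
    by (simp add: mpoly_adjoint_deriv[symmetric] L_poly_deriv(1) mpoly_adjoint_mult[of _ N N _ N])
  also have "mpoly_deriv L_poly * ?L = L_poly * (?L * ?E)"
    by (simp only: L_poly_deriv AL[symmetric]) (simp add: assoc)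
  finally have deriv: "mpoly_deriv S_poly = S_poly * ?E + S_poly * ?A"
    by (simp add: S_poly_def assoc)
  have "mpoly_adjoint V_poly = [:0, 2:] \<cdot>\<^sub>m 1\<^sub>m N - ?E - ?A"
    by (rule eq_matI)
      (auto simp: V_poly_def mpoly_adjoint_def map_poly_cnj_diff map_poly_pCons E_poly_def A_poly_def A_mat_def
        const_mpoly_def conj_\<alpha>_def)
  then have "S_poly * mpoly_adjoint V_poly = [:0, 2:] \<cdot>\<^sub>m S_poly - S_poly * ?E - S_poly * ?A"
    by (simp add: right_mult_one_mat[of _ N N] mult_minus_distrib_mat[of _ N N _ N] mult_smult_distrib[of _ N N _ N])
  then show ?thesis
    unfolding deriv by (simp only:) (rule mat_add_eq_diff_diff[of _ N N], simp_all)
qed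

lemma mdegree_le_V_poly: "mdegree_le 2 V_poly"
  by (auto simp: mdegree_le_def V_poly_def E_poly_def A_poly_def A_mat_def const_mpoly_def conj_\<alpha>_def
      intro!: degree_diff_le degree_add_le degree_smult_le[THEN order_trans])

lemma mcoeff_V_poly: "mcoeff 2 V_poly = A_mat N \<alpha>"
  by (rule eq_matI)
    (auto simp: mcoeff_def V_poly_def E_poly_def A_poly_def A_mat_def const_mpoly_def conj_\<alpha>_def numeral_2_eq_2)

text \<open>
  The integral is that of \<open>(F L) (F L)\<^sup>*\<close>, so \<open>F L = 0\<close>; and \<open>L\<close> is invertible over the polynomials, being
  lower triangular with unit diagonal.
\<close>

lemma S_poly_definite:
  assumes "F \<in> carrier_mat N N" "mgint (F * S_poly * mpoly_adjoint F) = 0\<^sub>m N N"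
  shows "F = 0\<^sub>m N N"
proof -
  have "F * S_poly * mpoly_adjoint F = F * L_poly * mpoly_adjoint (F * L_poly)"
    using assms(1) by (simp add: S_poly_def mpoly_adjoint_mult[of _ N N _ N] assoc_mult_mat[of _ N N _ N _ N])
  with assms have FL: "F * L_poly = 0\<^sub>m N N"
    by (intro mgint_definite[of _ N N]) simp_all
  have "det L_poly = prod_list (diag_mat L_poly)"
    by (rule det_lower_triangular[of N]) (simp_all add: L_poly_def conj_\<alpha>_def hermite_int_neg)
  also have "diag_mat L_poly = map (\<lambda>_. 1) [0..<N]"
    unfolding diag_mat_def
    by (rule map_cong) (use \<alpha>_nonzero in \<open>auto simp: L_poly_def conj_\<alpha>_def hermite_int_def\<close>)
  also have "prod_list \<dots> = (1 :: complex poly)" by (rule prod_list_neutral) auto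
  finally have "det L_poly = 1" .
  moreover have "(1 :: complex poly) \<cdot>\<^sub>m 1\<^sub>m N = 1\<^sub>m N" by (rule eq_matI) auto
  ultimately have "L_poly * adj_mat L_poly = 1\<^sub>m N"
    using adj_mat(2)[of L_poly N] by simp
  then have "F = F * (L_poly * adj_mat L_poly)" using assms(1) by simp
  also have "\<dots> = F * L_poly * adj_mat L_poly"
    using assms(1) adj_mat(1)[of L_poly N] by (intro assoc_mult_mat[symmetric, of _ N N _ N _ N]) simp_all
  also have "\<dots> = 0\<^sub>m N N"
    unfolding FL using adj_mat(1)[of L_poly N] by (intro left_mult_zero_mat) simp_all
  finally show ?thesis .
qed

lemma mpoly_at_L_poly: "mpoly_at L_poly x = L_mat N \<alpha> x"
  by (rule eq_matI)
    (auto simp: mpoly_at_def L_poly_def L_mat_def conj_\<alpha>_def hermite_int_def poly_hermite_normalized nat_diff_distrib)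

lemma mvip_eq_mgint:
  assumes "F \<in> carrier_mat N N" "G \<in> carrier_mat N N"
  shows "mvip N (W_mat N \<alpha>) F G = mgint (F * S_poly * mpoly_adjoint G)"
proof (rule eq_matI)
  fix i k assume "i < dim_row (mgint (F * S_poly * mpoly_adjoint G))" "k < dim_col (mgint (F * S_poly * mpoly_adjoint G))"
  then have ik: "i < N" "k < N" using assms by (auto simp: mgint_def mpoly_adjoint_def)
  have "mpoly_at F y * W_mat N \<alpha> y * mat_adjoint (mpoly_at G y) =
      complex_of_real (exp (- (y\<^sup>2))) \<cdot>\<^sub>m mpoly_at (F * S_poly * mpoly_adjoint G) y" for y
  proof -
    have W: "W_mat N \<alpha> y = complex_of_real (exp (- (y\<^sup>2))) \<cdot>\<^sub>m mpoly_at S_poly y"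
      unfolding W_mat_def S_poly_def mpoly_at_L_poly[symmetric] mpoly_at_adjoint[symmetric]
      by (simp add: mpoly_at_mult[of _ N N _ N])
    show ?thesis
      unfolding W using assms
      by (simp add: mpoly_at_mult[of _ N N _ N] mpoly_at_adjoint[symmetric] mult_smult_distrib[of _ N N _ N]
          mult_smult_assoc_mat[of _ N N _ N] del: assoc_mult_mat)
  qed
  then show "mvip N (W_mat N \<alpha>) F G $$ (i, k) = mgint (F * S_poly * mpoly_adjoint G) $$ (i, k)"
    using ik assms
    by (simp add: mvip_def mgint_def gint_def mpoly_at_def mpoly_adjoint_def del: index_mult_mat(1) assoc_mult_mat)
qed (use assms in \<open>auto simp: mvip_def mgint_def mpoly_adjoint_def\<close>)

end

section \<open>The lowering relation\<close>

lemma monic_mpoly_iff: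
  "monic_mpoly N n F \<longleftrightarrow> F \<in> carrier_mat N N \<and> mdegree_le n F \<and> mcoeff n F = 1\<^sub>m N"
  by (auto simp: monic_mpoly_def mdegree_le_def mcoeff_def)

lemma lowering_equation_iff:
  assumes "M \<in> carrier_mat N N" "F \<in> carrier_mat N N" "G \<in> carrier_mat N N" "H \<in> carrier_mat N N"
  shows "(\<forall>x. mpoly_at (mpoly_deriv F) x = c \<cdot>\<^sub>m mpoly_at G x + M * mpoly_at H x) \<longleftrightarrow>
    mpoly_deriv F = const_mpoly (c \<cdot>\<^sub>m 1\<^sub>m N) * G + const_mpoly M * H"
proof -
  have const: "mpoly_at (const_mpoly C) x = C" for C x
    by (rule eq_matI) (auto simp: mpoly_at_def const_mpoly_def)
  have at: "mpoly_at (const_mpoly (c \<cdot>\<^sub>m 1\<^sub>m N) * G + const_mpoly M * H) x = c \<cdot>\<^sub>m mpoly_at G x + M * mpoly_at H x" for x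
  proof -
    have "mpoly_at (const_mpoly (c \<cdot>\<^sub>m 1\<^sub>m N) * G + const_mpoly M * H) x =
        mpoly_at (const_mpoly (c \<cdot>\<^sub>m 1\<^sub>m N) * G) x + mpoly_at (const_mpoly M * H) x"
      using assms by (intro eq_matI) (auto simp: mpoly_at_def const_mpoly_def simp del: index_mult_mat(1))
    also have "\<dots> = (c \<cdot>\<^sub>m 1\<^sub>m N) * mpoly_at G x + M * mpoly_at H x"
      using assms by (simp add: mpoly_at_mult[of _ N N _ N] const)
    also have "(c \<cdot>\<^sub>m 1\<^sub>m N) * mpoly_at G x = c \<cdot>\<^sub>m mpoly_at G x"
      using assms by (simp add: mult_smult_assoc_mat[of _ N N _ N] left_mult_one_mat[of _ N N])
    finally show ?thesis .
  qed
  show ?thesis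
    unfolding at[symmetric] using assms by (auto intro!: mpoly_at_inject[of _ N N])
qed

theorem proposition6p3:
  fixes N :: nat
    and \<alpha> :: "nat \<Rightarrow> real"
    and P :: "nat \<Rightarrow> complex poly mat"
  assumes "1 \<le> N"
    and "\<forall>j\<in>{1..N}. 0 < \<alpha> j"
    and "\<forall>j\<in>{2..N}. 2 * \<alpha> j / \<alpha> (j - 1) = sqrt ((real j - 1) * (real N - real j + 1))"
    and "monic_mvops N (W_mat N \<alpha>) P"
  shows "(\<exists>M. lowering_relation N P M) \<and>
    (\<forall>M. lowering_relation N P M \<longrightarrow>
      (\<forall>n\<ge>2. M n = sq_norm N (W_mat N \<alpha>) P n * mat_adjoint (A_mat N \<alpha>) *
        mat_inv (sq_norm N (W_mat N \<alpha>) P (n - 2))))"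
proof -
  interpret hermite_weight N \<alpha>
    using assms by unfold_locales auto
  have monic: "monic_mpoly N n (P n)" for n using assms(4) by (simp add: monic_mvops_def)
  then have P [simp]: "P n \<in> carrier_mat N N" for n by (simp add: monic_mpoly_iff)
  interpret gaussian_mvops N S_poly V_poly P
  proof
    show "mgint (P n * S_poly * mpoly_adjoint (P m)) = 0\<^sub>m N N" if "n \<noteq> m" for n m
      using assms(4) that by (simp add: monic_mvops_def flip: mvip_eq_mgint)
  qed (use monic S_poly_pearson S_poly_definite mdegree_le_V_poly in \<open>auto simp: monic_mpoly_iff\<close>)
  let ?M = "\<lambda>n. sq_norm N (W_mat N \<alpha>) P n * mat_adjoint (A_mat N \<alpha>) * mat_inv (sq_norm N (W_mat N \<alpha>) P (n - 2))"
  have sq_norm: "sq_norm N (W_mat N \<alpha>) P n = form (P n) (P n)" for n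
    by (simp add: sq_norm_def form_def mvip_eq_mgint)
  have M_carrier: "?M n \<in> carrier_mat N N" for n
    unfolding sq_norm using mat_inv_inverse(1)[OF _ det_norm_nonzero] by auto
  have step: "(\<forall>x. mpoly_at (mpoly_deriv (P n)) x =
      of_nat n \<cdot>\<^sub>m mpoly_at (P (n - 1)) x + C * mpoly_at (P (n - 2)) x) \<longleftrightarrow> C = ?M n"
    if C: "C \<in> carrier_mat N N" and "2 \<le> n" for C n
  proof -
    obtain k where n: "n = k + 2" using \<open>2 \<le> n\<close> by (metis le_add_diff_inverse2)
    then have k: "n - 1 = k + 1" "n - 2 = k" by simp_all
    show ?thesis
      unfolding lowering_equation_iff[OF C P P P] k unfolding n sq_norm
      using lowering_iff_inverse[OF C, of k] unfolding mcoeff_V_poly .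
  qed
  have "lowering_relation N P ?M"
    unfolding lowering_relation_def using step M_carrier by blast
  moreover have "M n = ?M n" if "lowering_relation N P M" "2 \<le> n" for M n
    using that step[of "M n" n] unfolding lowering_relation_def by blast
  ultimately show ?thesis by blast
qed

end
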